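(* Let $\eta_A$ be the unique number in the interval $(1,2)$ satisfying $(1-2^{-\eta_A})(1-3^{-\eta_A})(1-3^{-\eta_A}+3^{-2\eta_A})=\frac{1}{\zeta(\eta_A)}$ (numerically $\eta_A\approx 1.9011618$). If $r>1$, then the range $\{s_{-r}(n):n\in\mathbb{N}\}$ of $s_{-r}$ is dense in the interval $\left(\frac{1}{\zeta(r)},1\right]$ if and only if $r\leq\eta_A$.
   Context: For a real number $t$, $s_t$ denotes the multiplicative arithmetic function defined by $s_t(p^{\alpha})=\sum_{j=0}^{\alpha}(-p^t)^j$ for all primes $p$ and positive integers $\alpha$. $\zeta$ is the Riemann zeta function. *)

theory Defs
  imports "HOL-Analysis.Analysis" "HOL-Number_Theory.Number_Theory"
begin

text \<open>The Riemann zeta function on the half-line \<open>r > 1\<close>, where it is given by its Dirichlet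
  series. Outside that range the series diverges and the value is meaningless.\<close>

definition zeta :: "real \<Rightarrow> real" where
  "zeta r = (\<Sum>n. 1 / real (Suc n) powr r)"

text \<open>The lemmas below show that this is the multiplicative function determined by the
  given values at prime powers. The value at \<open>n = 0\<close> (junk value 1) is not part of
  the arithmetic function.\<close>

definition s_fun :: "real \<Rightarrow> nat \<Rightarrow> real" where
  "s_fun t n = (\<Prod>p\<in>prime_factors n. \<Sum>j=0..multiplicity p n. (- (real p powr t)) ^ j)"

lemma s_fun_1: "s_fun t 1 = 1"
  by (simp add: s_fun_def)

lemma s_fun_prime_power:
  fixes p \<alpha> :: nat
  assumes "prime p" "\<alpha> > 0"
  shows "s_fun t (p ^ \<alpha>) = (\<Sum>j=0..\<alpha>. (- (real p powr t)) ^ j)"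
  using assms by (simp add: s_fun_def prime_factorization_prime_power)

lemma s_fun_mult_coprime:
  fixes m n :: nat
  assumes "m > 0" "n > 0" "coprime m n"
  shows "s_fun t (m * n) = s_fun t m * s_fun t n"
proof -
  have disj: "prime_factors m \<inter> prime_factors n = {}"
    using assms(3) by (metis coprime_common_divisor disjoint_iff in_prime_factors_iff not_prime_unit)
  have pf: "prime_factors (m * n) = prime_factors m \<union> prime_factors n"
    using assms by (simp add: prime_factors_product)
  have 1: "multiplicity p (m * n) = multiplicity p m" if "p \<in> prime_factors m" for p
  proof -
    have "\<not> p dvd n" using that disj assms by (auto simp: prime_factors_dvd)
    then show ?thesis
      using that assms
      by (simp add: prime_elem_multiplicity_mult_distrib not_dvd_imp_multiplicity_0 in_prime_factors_iff)
  qed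
  have 2: "multiplicity p (m * n) = multiplicity p n" if "p \<in> prime_factors n" for p
  proof -
    have "\<not> p dvd m" using that disj assms by (auto simp: prime_factors_dvd)
    then show ?thesis
      using that assms
      by (simp add: prime_elem_multiplicity_mult_distrib not_dvd_imp_multiplicity_0 in_prime_factors_iff)
  qed
  show ?thesis
    unfolding s_fun_def pf using disj 1 2
    by (simp add: prod.union_disjoint cong: prod.cong)
qed

definition is_eta_A :: "real \<Rightarrow> bool" where
  "is_eta_A \<eta> \<longleftrightarrow> \<eta> \<in> {1<..<2} \<and>
     (1 - 2 powr (-\<eta>)) * (1 - 3 powr (-\<eta>)) * (1 - 3 powr (-\<eta>) + 3 powr (-2 * \<eta>)) = 1 / zeta \<eta>"

definition eta_A :: real where
  "eta_A = (THE \<eta>. is_eta_A \<eta>)"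

text \<open>\<open>A \<inter> I\<close> is dense in \<open>I\<close>; in the application \<open>A \<subseteq> I\<close>, so the intersection is immaterial.\<close>

definition dense_in :: "real set \<Rightarrow> real set \<Rightarrow> bool" where
  "dense_in A I \<longleftrightarrow> I \<subseteq> closure (A \<inter> I)"

end

theory Submission
  imports Defs
begin

text \<open>
  Write \<open>x\<^sub>p = p powr -r\<close> and let \<open>R\<^sub>k\<close> be the product of \<open>1 - x\<^sub>p\<close> over the primes \<open>p > k\<close>, so that
  \<open>R\<^sub>0 = 1 / zeta r\<close>. The factors of \<open>s_fun (-r)\<close> at \<open>p\<close> are \<open>1\<close> and numbers between \<open>1 - x\<^sub>p\<close> and
  \<open>1 - x\<^sub>p + x\<^sub>p\<^sup>2\<close>; the gap below \<open>1\<close> is the widest one on a logarithmic scale. If \<open>R\<^sub>q \<le> 1 - x\<^sub>q + x\<^sub>q\<^sup>2\<close>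
  for every prime \<open>q\<close>, then the primes beyond \<open>q\<close> bridge this gap, and a greedy choice of
  exponents, prime after prime, approximates every number in the interval. If the condition fails at
  \<open>q = 3\<close>, then no value lies between \<open>1 - x\<^sub>3 + x\<^sub>3\<^sup>2\<close> and \<open>R\<^sub>3\<close>.

  For \<open>r \<le> 2\<close> the condition always holds at \<open>q \<ge> 5\<close>, because \<open>(q / p)\<^sup>2\<close> summed over the primes
  \<open>p > q\<close> is at least \<open>1\<close>: for \<open>q \<ge> 10\<close> each of the intervals from \<open>2\<^sup>k q\<close> to \<open>2\<^sup>k\<^sup>+\<^sup>1 q\<close> contains three
  primes, by Erdos' proof of Bertrand's postulate. The condition at \<open>2\<close> follows from the one at \<open>3\<close>.
  At \<open>q = 3\<close> the quotient \<open>ln R\<^sub>3 / ln (1 - x\<^sub>3 + x\<^sub>3\<^sup>2)\<close> decreases in \<open>r\<close>, so that equality holds for exactly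
  one \<open>r\<close>, which is \<open>eta_A\<close>.
\<close>

section \<open>Three primes between n and 2n\<close>

text \<open>Legendre's formula, cut off at \<open>L\<close> because higher powers of
  \<open>p\<close> exceed \<open>n\<close>. In the induction, \<open>n div p ^ i\<close> grows by
  one exactly when \<open>p ^ i\<close> divides \<open>Suc n\<close>, and the multiplicity counts
  these \<open>i\<close>.\<close>

lemma sum_div_power_eq_multiplicity_fact:
  fixes p n L :: nat
  assumes "prime p" "n < p ^ Suc L"
  shows "multiplicity p (fact n :: nat) = (\<Sum>i=1..L. n div p ^ i)"
  using assms(2)
proof (induction n)
  case 0
  then show ?case by simp
next
  case (Suc n)
  have p: "p > 1" using assms(1) prime_gt_1_nat by blast
  have "multiplicity p (Suc n) = card {1..multiplicity p (Suc n)}" by simp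
  also have "{1..multiplicity p (Suc n)} = {i\<in>{1..L}. p ^ i dvd Suc n}"
  proof -
    have "i \<le> L" if "p ^ i dvd Suc n" for i
    proof (rule ccontr)
      assume "\<not> i \<le> L"
      then have "p ^ Suc L dvd p ^ i" by (intro le_imp_power_dvd) auto
      then have "p ^ Suc L dvd Suc n" using that dvd_trans by blast
      then show False using Suc.prems dvd_imp_le by fastforce
    qed
    then show ?thesis using p
      by (auto simp: power_dvd_iff_le_multiplicity)
  qed
  also have "card \<dots> = (\<Sum>i=1..L. if p ^ i dvd Suc n then 1 else 0)"
    by (simp add: sum.If_cases Int_def)
  finally have m: "multiplicity p (Suc n) = \<dots>" .
  have "multiplicity p (fact (Suc n) :: nat) = multiplicity p (Suc n) + multiplicity p (fact n :: nat)"
    using assms(1) by (simp add: prime_elem_multiplicity_mult_distrib del: mult_Suc)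
  also have "\<dots> = (\<Sum>i=1..L. (if p ^ i dvd Suc n then 1 else 0) + n div p ^ i)"
    using Suc m by (simp add: sum.distrib)
  also have "\<dots> = (\<Sum>i=1..L. Suc n div p ^ i)"
    by (intro sum.cong refl) (auto simp: div_Suc dvd_eq_mod_eq_0)
  finally show ?case .
qed

lemma multiplicity_central_binomial:
  fixes p n L :: nat
  assumes "prime p" "2 * n < p ^ Suc L"
  shows "multiplicity p ((2 * n) choose n) = (\<Sum>i=1..L. (2 * n) div p ^ i - 2 * (n div p ^ i))"
proof -
  have "fact n * fact n * ((2 * n) choose n) = (fact (2 * n) :: nat)"
    using binomial_fact_lemma[of n "2 * n"] by (simp add: mult_2)
  then have "multiplicity p (fact (2 * n) :: nat) =
      2 * multiplicity p (fact n :: nat) + multiplicity p ((2 * n) choose n)"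
    using assms(1) by (simp add: prime_elem_multiplicity_mult_distrib flip: \<open>_ = fact (2 * n)\<close>)
  moreover have "multiplicity p (fact (2 * n) :: nat) = (\<Sum>i=1..L. (2 * n) div p ^ i)"
    using assms by (intro sum_div_power_eq_multiplicity_fact)
  moreover have "multiplicity p (fact n :: nat) = (\<Sum>i=1..L. n div p ^ i)"
    using assms by (intro sum_div_power_eq_multiplicity_fact) auto
  moreover have "2 * (n div d) \<le> (2 * n) div d" for d
    by (metis mult.commute div_mult1_eq le_add1)
  ultimately show ?thesis
    by (simp add: sum_subtractf_nat sum_distrib_left)
qed

lemma double_div_diff_le_1: "(2 * n) div d - 2 * (n div d) \<le> (1 :: nat)"
proof (cases "d = 0")
  case False
  then have "2 * n < d * (2 * (n div d) + 2)"
    using dividend_less_times_div[of d n] by (simp add: algebra_simps)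
  then have "(2 * n) div d < 2 * (n div d) + 2"
    by (simp add: less_mult_imp_div_less mult.commute)
  then show ?thesis by simp
qed auto

text \<open>If \<open>p ^ v\<close> exceeded \<open>2 * n\<close> for the multiplicity
  \<open>v\<close>, Legendre's formula could be cut off after \<open>v - 1\<close> terms. Each of
  them is at most 1, so they cannot add up to \<open>v\<close>.\<close>

lemma power_multiplicity_central_binomial_le:
  fixes p n :: nat
  assumes "prime p" "n > 0"
  shows "p ^ multiplicity p ((2 * n) choose n) \<le> 2 * n"
proof (rule ccontr)
  define v where "v = multiplicity p ((2 * n) choose n)"
  assume "\<not> ?thesis"
  then have *: "2 * n < p ^ v" by (simp add: v_def)
  then have "v > 0" using assms by (cases v) auto
  then obtain L where L: "v = Suc L" by (cases v) auto
  have "v = (\<Sum>i=1..L. (2 * n) div p ^ i - 2 * (n div p ^ i))"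
    unfolding v_def using assms * L by (intro multiplicity_central_binomial) auto
  also have "\<dots> \<le> (\<Sum>i=1..L. 1)" by (intro sum_mono double_div_diff_le_1)
  finally show False using L by simp
qed

text \<open>Such a \<open>p\<close> occurs twice in \<open>fact (2 * n)\<close> and once in each of
  the two copies of \<open>fact n\<close>. As \<open>p \<ge> 3\<close>, its square exceeds
  \<open>2 * n\<close>, so only the first term of Legendre's formula counts.\<close>

lemma multiplicity_central_binomial_eq_0:
  fixes p n :: nat
  assumes "prime p" "p \<ge> 3" "2 * n < 3 * p" "p \<le> n"
  shows "multiplicity p ((2 * n) choose n) = 0"
proof -
  have "3 * p \<le> p * p" using assms by (intro mult_le_mono) auto
  then have "2 * n < p * p" using assms by linarith
  then have "2 * n < p ^ Suc 1" by simp
  then have "multiplicity p ((2 * n) choose n) = (\<Sum>i=1..1. (2 * n) div p ^ i - 2 * (n div p ^ i))"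
    using assms by (intro multiplicity_central_binomial) auto
  also have "\<dots> = (2 * n) div p - 2 * (n div p)" by simp
  also have "(2 * n) div p = 2" using assms by (intro div_nat_eqI) auto
  also have "n div p = 1" using assms by (intro div_nat_eqI) auto
  finally show ?thesis by simp
qed

lemma prod_primes_dvd:
  fixes N :: nat
  assumes "finite P" "\<And>p. p \<in> P \<Longrightarrow> prime p" "\<And>p. p \<in> P \<Longrightarrow> p dvd N"
  shows "\<Prod>P dvd N"
  using assms
proof (induction rule: finite_induct)
  case (insert p P)
  have "coprime p (\<Prod>P)"
    using insert by (intro prod_coprime_right primes_coprime) auto
  then show ?case using insert by (simp add: divides_mult)
qed auto

text \<open>Erdos' argument by strong induction. Even \<open>n > 2\<close> reduces to
  \<open>n - 1\<close>; for \<open>n = 2 * m + 1\<close> the primes above \<open>m + 1\<close> all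
  divide \<open>n choose m\<close>, which is at most \<open>4 ^ m\<close>.\<close>

lemma primorial_le: "\<Prod>{p::nat. prime p \<and> p \<le> n} \<le> 4 ^ n"
proof (induction n rule: less_induct)
  case (less n)
  consider "n < 2" | "n = 2" | "n > 2" "even n" | "n > 2" "odd n"
    by linarith
  then show ?case
  proof cases
    case 1
    then have "\<not> (prime p \<and> p \<le> n)" for p :: nat
      using prime_ge_2_nat[of p] by linarith
    then have "{p::nat. prime p \<and> p \<le> n} = {}" by blast
    then show ?thesis by (simp only: prod.empty one_le_numeral one_le_power)
  next
    case 2
    have "prime p \<and> p \<le> n \<longleftrightarrow> p = 2" for p :: nat
      using 2 prime_ge_2_nat[of p] two_is_prime_nat by (metis le_antisym order_refl)
    then show ?thesis using 2 by simp
  next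
    case 3
    have "\<not> prime n"
      using 3 primes_dvd_imp_eq[OF two_is_prime_nat, of n] by auto
    then have "p \<noteq> n" if "prime p" for p using that by blast
    then have "{p::nat. prime p \<and> p \<le> n} = {p. prime p \<and> p \<le> n - 1}"
      using 3 by (intro Collect_cong) (metis Suc_pred' le_SucE le_SucI less_imp_le_nat zero_less_numeral less_trans)
    then have "\<Prod>{p::nat. prime p \<and> p \<le> n} \<le> 4 ^ (n - 1)"
      using less.IH[of "n - 1"] 3 by simp
    also have "\<dots> \<le> 4 ^ n" by (intro power_increasing) auto
    finally show ?thesis .
  next
    case odd: 4
    obtain m where "n = 2 * m + 1" using odd(2) by (rule oddE)
    with odd(1) have 4: "n = 2 * m + 1" "m > 0" by auto
    let ?A = "{p::nat. prime p \<and> p \<le> Suc m}" and ?B = "{p::nat. prime p \<and> Suc m < p \<and> p \<le> n}"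
    have "\<Prod>?B dvd (n choose m)"
    proof (rule prod_primes_dvd)
      fix p assume "p \<in> ?B"
      then have p: "prime p" "Suc m < p" "p \<le> n" by auto
      have "fact m * fact (n - m) * (n choose m) = (fact n :: nat)"
        using 4 by (intro binomial_fact_lemma) auto
      moreover have "p dvd fact n" using p by (simp add: prime_dvd_fact_iff)
      moreover have "\<not> p dvd fact m" "\<not> p dvd fact (n - m)"
        unfolding prime_dvd_fact_iff[OF p(1)] using p 4 by linarith+
      ultimately show "p dvd n choose m"
        using p(1) by (metis (no_types) prime_dvd_multD)
    qed auto
    then have "\<Prod>?B \<le> n choose m"
      using 4 by (intro dvd_imp_le) auto
    moreover have "n choose m \<le> 4 ^ m"
    proof -
      \<comment> \<open>The two middle entries of an odd row are equal, so each is at most half of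
        the row sum \<open>2 ^ n\<close>.\<close>
      have "(n choose m) + (n choose Suc m) = (\<Sum>k\<in>{m, Suc m}. n choose k)" by simp
      also have "\<dots> \<le> (\<Sum>k\<le>n. n choose k)" using 4 by (intro sum_mono2) auto
      also have "\<dots> = 2 ^ n" by (rule choose_row_sum)
      finally have "2 * (n choose m) \<le> 2 ^ n" using 4 binomial_symmetric[of m n] by simp
      then show ?thesis using 4 by (simp add: power_mult)
    qed
    ultimately have B: "\<Prod>?B \<le> 4 ^ m" by simp
    have "{p::nat. prime p \<and> p \<le> n} = ?A \<union> ?B" using 4 by auto
    then have "\<Prod>{p::nat. prime p \<and> p \<le> n} = \<Prod>?A * \<Prod>?B"
      by (simp add: prod.union_disjoint disjoint_iff)
    also have "\<dots> \<le> 4 ^ Suc m * 4 ^ m"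
      using 4 by (intro mult_le_mono B less.IH) auto
    also have "\<dots> = 4 ^ n" using 4 by (simp add: power_add mult_2)
    finally show ?thesis .
  qed
qed

text \<open>Prime powers in the coefficient are at most \<open>2 * n\<close>; this bound is spent on
  the primes up to \<open>s\<close> and above \<open>n\<close>. The primes in between have exponent
  at most 1, and 0 beyond \<open>2 * n div 3\<close>, so the primorial bound covers them.\<close>

lemma central_binomial_le:
  fixes n s :: nat
  assumes "n \<ge> 3" "2 * n < (Suc s)\<^sup>2"
  shows "(2 * n) choose n \<le>
    (2 * n) ^ (s + card {p. prime p \<and> n < p \<and> p \<le> 2 * n}) * 4 ^ (2 * n div 3)"
proof -
  define N where "N = (2 * n) choose n"
  define m where "m = 2 * n div 3"
  define P where "P = {p::nat. prime p \<and> p \<le> 2 * n}"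
  have fin: "finite P" by (simp add: P_def)
  have "N \<noteq> 0" by (simp add: N_def)
  then have "N = (\<Prod>p\<in>prime_factors N. p ^ multiplicity p N)"
    by (intro prime_factorization_nat) auto
  also have "\<dots> = (\<Prod>p\<in>P. p ^ multiplicity p N)"
  proof (rule prod.mono_neutral_left[OF fin])
    show "prime_factors N \<subseteq> P"
    proof
      fix p assume "p \<in> prime_factors N"
      then have p: "prime p" "p dvd N" by auto
      have "N dvd fact (2 * n)"
        using binomial_fact_lemma[of n "2 * n"] unfolding N_def by (metis dvd_triv_right le_add1 mult_2)
      then have "p dvd fact (2 * n)" using p dvd_trans by blast
      then show "p \<in> P" using p by (simp add: P_def prime_dvd_fact_iff)
    qed
    show "\<forall>i\<in>P - prime_factors N. i ^ multiplicity i N = 1"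
      by (auto simp: P_def prime_factors_dvd \<open>N \<noteq> 0\<close> not_dvd_imp_multiplicity_0)
  qed
  also have "\<dots> \<le> (\<Prod>p\<in>P. (if p \<le> s \<or> n < p then 2 * n else 1) * (if p \<le> m then p else 1))"
  proof (rule prod_mono, safe)
    fix p assume "p \<in> P"
    then have p: "prime p" "p \<le> 2 * n" by (auto simp: P_def)
    have p1: "p \<ge> 1" using p prime_ge_1_nat by blast
    have le: "p ^ multiplicity p N \<le> 2 * n"
      using power_multiplicity_central_binomial_le[OF p(1)] assms by (simp add: N_def)
    show "p ^ multiplicity p N \<le> (if p \<le> s \<or> n < p then 2 * n else 1) * (if p \<le> m then p else 1)"
    proof (cases "p \<le> s \<or> n < p")
      case True
      have "2 * n * 1 \<le> 2 * n * (if p \<le> m then p else 1)" using p1 by (intro mult_le_mono) auto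
      with le have "p ^ multiplicity p N \<le> 2 * n * (if p \<le> m then p else 1)" by linarith
      then show ?thesis using True by (simp only: if_True simp_thms)
    next
      case False
      then have "(Suc s)\<^sup>2 \<le> p\<^sup>2" by (intro power_mono) auto
      then have "2 * n < p ^ 2" using assms by linarith
      have "multiplicity p N \<le> 1"
      proof (rule ccontr)
        assume "\<not> ?thesis"
        then have "p ^ 2 \<le> p ^ multiplicity p N" using p1 by (intro power_increasing) auto
        then show False using \<open>2 * n < p ^ 2\<close> le by simp
      qed
      moreover have "multiplicity p N = 0" if "p > m"
      proof -
        have "2 * n < 3 * p" using that by (simp add: m_def)
        \<comment> \<open>For \<open>p = 2\<close> this would read \<open>2 * n < 6\<close>,
          contrary to \<open>n \<ge> 3\<close>.\<close>
        moreover from this have "p \<noteq> 2" using assms by auto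
        then have "p \<ge> 3" using prime_ge_2_nat[OF p(1)] by simp
        ultimately show ?thesis
          unfolding N_def using p False by (intro multiplicity_central_binomial_eq_0) auto
      qed
      ultimately have "p ^ multiplicity p N \<le> (if p \<le> m then p else 1)"
        using p1 power_increasing[of "multiplicity p N" 1 p] by auto
      then show ?thesis using False by simp
    qed
  qed
  also have "\<dots> = (2 * n) ^ card {p\<in>P. p \<le> s \<or> n < p} * \<Prod>{p\<in>P. p \<le> m}"
    using fin by (simp add: prod.distrib prod.If_cases Int_def)
  also have "\<dots> \<le> (2 * n) ^ (s + card {p. prime p \<and> n < p \<and> p \<le> 2 * n}) * 4 ^ m"
  proof (rule mult_le_mono)
    have "card {p\<in>P. p \<le> s \<or> n < p} \<le> card ({1..s} \<union> {p. prime p \<and> n < p \<and> p \<le> 2 * n})"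
      by (intro card_mono) (auto simp: P_def prime_ge_1_nat[unfolded One_nat_def])
    also have "\<dots> \<le> s + card {p. prime p \<and> n < p \<and> p \<le> 2 * n}"
      using card_Un_le[of "{1..s}"] by simp
    finally show "(2 * n) ^ card {p\<in>P. p \<le> s \<or> n < p} \<le>
        (2 * n) ^ (s + card {p. prime p \<and> n < p \<and> p \<le> 2 * n})"
      using assms by (intro power_increasing) auto
    have "{p\<in>P. p \<le> m} = {p. prime p \<and> p \<le> m}" by (auto simp: P_def m_def)
    then show "\<Prod>{p\<in>P. p \<le> m} \<le> 4 ^ m" using primorial_le[of m] by simp
  qed
  finally show ?thesis by (simp add: N_def m_def)
qed

lemma ln_bound_of_ge_38:
  fixes w :: real
  assumes "w \<ge> 38"
  shows "6 * (w + 3) * ln w < w\<^sup>2 * ln 2"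
proof -
  \<comment> \<open>The tangent of \<open>ln\<close> at 32: a power of 2, so that only
    \<open>ln 2\<close> appears, and close to the lower end 38.\<close>
  have "ln (w / 32) \<le> w / 32 - 1" using assms by (intro ln_le_minus_one) auto
  moreover have "ln (w / 32) = ln w - 5 * ln 2"
    using assms ln_realpow[of 2 5] by (simp add: ln_div)
  ultimately have "ln w \<le> 5 * ln 2 + w / 32 - 1" by simp
  then have 1: "6 * (w + 3) * ln w \<le> 6 * (w + 3) * (5 * ln 2 + w / 32 - 1)"
    using assms by (intro mult_left_mono) auto
  have pos: "w\<^sup>2 - 30 * w - 90 > 0"
  proof -
    have "w * w \<ge> 38 * w" using assms by (intro mult_right_mono) auto
    then show ?thesis using assms unfolding power2_eq_square by linarith
  qed
  have "(w\<^sup>2 - 30 * w - 90) * (2/3) \<le> (w\<^sup>2 - 30 * w - 90) * ln 2"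
    using pos ln2_ge_two_thirds by (intro mult_left_mono) auto
  moreover have "6 * (w + 3) * (w / 32 - 1) < (w\<^sup>2 - 30 * w - 90) * (2/3)"
  proof -
    have "w * w \<ge> 38 * w" using assms by (intro mult_right_mono) auto
    moreover have "6 * (w + 3) * (w / 32 - 1) = 3 / 16 * (w * w) - 87 / 16 * w - 18"
      by (simp add: field_simps)
    moreover have "(w\<^sup>2 - 30 * w - 90) * (2/3) = 2 / 3 * (w * w) - 20 * w - 60"
      by (simp add: power2_eq_square)
    ultimately show ?thesis using assms by (simp only:)
  qed
  ultimately have "6 * (w + 3) * (w / 32 - 1) < (w\<^sup>2 - 30 * w - 90) * ln 2" by linarith
  then have "6 * (w + 3) * (5 * ln 2 + w / 32 - 1) < w\<^sup>2 * ln 2"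
    by (simp add: algebra_simps)
  with 1 show ?thesis by linarith
qed

text \<open>With at most two such primes, the bounds on the central binomial coefficient give
  \<open>4 ^ n \<le> (2 * n) ^ (s + 3) * 4 ^ (2 * n div 3)\<close>, where \<open>s\<close> is the
  integer part of \<open>w = sqrt (2 * n)\<close>. Taking logarithms contradicts
  \<open>ln_bound_of_ge_38\<close>.\<close>

lemma three_primes_of_ge_722:
  fixes n :: nat
  assumes "n \<ge> 722"
  shows "card {p. prime p \<and> n < p \<and> p \<le> 2 * n} \<ge> 3"
proof (rule ccontr)
  define c where "c = card {p. prime p \<and> n < p \<and> p \<le> 2 * n}"
  assume "\<not> ?thesis"
  then have c: "c \<le> 2" by (simp add: c_def)
  define w where "w = sqrt (2 * real n)"
  have w2: "w\<^sup>2 = 2 * real n" by (simp add: w_def)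
  \<comment> \<open>This is where 722 comes from: \<open>2 * 722 = 38 * 38\<close>.\<close>
  have w: "w \<ge> 38" unfolding w_def using assms by (intro real_le_rsqrt) auto
  define s where "s = nat \<lfloor>w\<rfloor>"
  have s: "real s \<le> w" "w < real (Suc s)" using w unfolding s_def by linarith+
  have "2 * n < (Suc s)\<^sup>2"
  proof -
    have "w\<^sup>2 < (real (Suc s))\<^sup>2" using s w by (intro power_strict_mono) auto
    then have "real (2 * n) < real ((Suc s)\<^sup>2)" using w2 by simp
    then show ?thesis by linarith
  qed
  have "4 ^ n / (2 * real n) \<le> real ((2 * n) choose n)"
    using assms by (intro central_binomial_lower_bound) auto
  also have "\<dots> \<le> real ((2 * n) ^ (s + c) * 4 ^ (2 * n div 3))"
    using central_binomial_le[OF _ \<open>2 * n < (Suc s)\<^sup>2\<close>] assms unfolding c_def of_nat_le_iff by simp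
  also have "\<dots> \<le> real ((2 * n) ^ (s + 2) * 4 ^ (2 * n div 3))"
    using c assms unfolding of_nat_le_iff by (intro mult_le_mono power_increasing) auto
  finally have "4 ^ n \<le> (2 * real n) ^ (s + 3) * 4 ^ (2 * n div 3)"
    using assms by (simp add: field_simps power_add power3_eq_cube power2_eq_square)
  then have "ln (4 ^ n) \<le> ln ((2 * real n) ^ (s + 3) * 4 ^ (2 * n div 3))"
    using assms by (subst ln_le_cancel_iff) auto
  also have "\<dots> = (real s + 3) * ln (2 * real n) + real (2 * n div 3) * ln 4"
    using assms ln_realpow[of "2 * real n" "s + 3"] ln_realpow[of 4 "2 * n div 3"]
    by (subst ln_mult) (auto simp: add_ac simp del: power_mult_distrib)
  finally have "real n * ln 4 \<le> (real s + 3) * ln (2 * real n) + real (2 * n div 3) * ln 4"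
    by (simp add: ln_realpow)
  moreover have "real (2 * n div 3) * ln 4 \<le> (2 * real n / 3) * ln 4"
    using of_nat_div_le_of_nat[of "2 * n" 3, where 'a = real] by (intro mult_right_mono) auto
  moreover have "(real s + 3) * ln (2 * real n) \<le> (w + 3) * ln (2 * real n)"
    using s assms by (intro mult_right_mono) auto
  ultimately have "real n * ln 4 \<le> (w + 3) * ln (2 * real n) + (2 * real n / 3) * ln 4"
    by linarith
  then have "2 * real n * ln 4 \<le> 6 * ((w + 3) * ln (2 * real n))"
    by linarith
  moreover have "ln (2 * real n) = 2 * ln w"
    using w by (simp flip: w2 add: ln_realpow)
  moreover have "ln (4::real) = 2 * ln 2" using ln_realpow[of "2::real" 2] by simp
  ultimately have "w\<^sup>2 * ln 2 \<le> 6 * (w + 3) * ln w"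
    using w2 by (simp add: algebra_simps)
  then show False using ln_bound_of_ge_38[OF w] by simp
qed

section \<open>Explicit prime triples for small n\<close>

lemma three_primes_of_triple:
  fixes n a b c :: nat
  assumes "prime a" "prime b" "prime c" "a < b" "b < c" "c \<le> 2 * n"
    and "a \<le> n \<Longrightarrow> card {p. prime p \<and> n < p \<and> p \<le> 2 * n} \<ge> 3"
  shows "card {p. prime p \<and> n < p \<and> p \<le> 2 * n} \<ge> 3"
proof (cases "a \<le> n")
  case False
  then have "card {a, b, c} \<le> card {p. prime p \<and> n < p \<and> p \<le> 2 * n}"
    using assms by (intro card_mono) auto
  then show ?thesis using assms by simp
qed (rule assms)

lemma primeI_trial_division:
  fixes p s :: nat
  assumes "p > 1" "p < s * s" "\<forall>d\<in>set [2..<s]. \<not> d dvd p"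
  shows "prime p"
  unfolding prime_divisor_sqrt
proof (intro conjI allI impI)
  fix d assume d: "d dvd p \<and> d\<^sup>2 \<le> p"
  have "d < s"
  proof (rule ccontr)
    assume "\<not> d < s"
    then have "s * s \<le> d * d" by (intro mult_le_mono) auto
    then show False using d assms by (simp add: power2_eq_square)
  qed
  moreover have "d \<noteq> 0" using d assms(1) by (cases d) auto
  ultimately show "d = 1" using d assms(3) by force
qed (use assms in auto)

text \<open>Descends from 722 to 10. A triple with smallest prime \<open>a\<close> and largest prime
  \<open>c\<close> settles every \<open>n < a\<close> with \<open>c \<le> 2 * n\<close>; each
  threshold is half of \<open>c\<close>, rounded up, and \<open>a\<close> is at least the previous
  threshold.\<close>

lemma card_primes_between_double_ge_3:
  fixes n :: nat
  assumes "n \<ge> 10"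
  shows "card {p. prime p \<and> n < p \<and> p \<le> 2 * n} \<ge> 3"
proof -
  have P12: "prime (113::nat)" "prime (127::nat)" "prime (131::nat)"
    by (rule primeI_trial_division[of _ 12]; simp)+
  have P15: "prime (199::nat)" "prime (211::nat)" "prime (223::nat)"
    by (rule primeI_trial_division[of _ 15]; simp)+
  have P20: "prime (383::nat)" "prime (389::nat)" "prime (397::nat)"
    by (rule primeI_trial_division[of _ 20]; simp)+
  have P28: "prime (751::nat)" "prime (757::nat)" "prime (761::nat)"
    by (rule primeI_trial_division[of _ 28]; simp)+
  have P: "prime (13::nat)" "prime (17::nat)" "prime (19::nat)" "prime (23::nat)" "prime (29::nat)" "prime (31::nat)"
    "prime (37::nat)" "prime (41::nat)" "prime (43::nat)" "prime (67::nat)" "prime (71::nat)" "prime (73::nat)"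
    by simp_all
  let ?P = "card {p. prime p \<and> n < p \<and> p \<le> 2 * n} \<ge> 3"
  note rule = three_primes_of_triple[where n = n]
  have 1: ?P if "n \<ge> 722" using that by (rule three_primes_of_ge_722)
  have 2: ?P if "n \<ge> 381"
    by (rule rule[OF P28(1) P28(2) P28(3)]) (use that in linarith | rule 1)+
  have 3: ?P if "n \<ge> 199"
    by (rule rule[OF P20(1) P20(2) P20(3)]) (use that in linarith | rule 2)+
  have 4: ?P if "n \<ge> 112"
    by (rule rule[OF P15(1) P15(2) P15(3)]) (use that in linarith | rule 3)+
  have 5: ?P if "n \<ge> 66"
    by (rule rule[OF P12(1) P12(2) P12(3)]) (use that in linarith | rule 4)+
  have 6: ?P if "n \<ge> 37"
    by (rule rule[OF P(10) P(11) P(12)]) (use that in linarith | rule 5)+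
  have 7: ?P if "n \<ge> 22"
    by (rule rule[OF P(7) P(8) P(9)]) (use that in linarith | rule 6)+
  have 8: ?P if "n \<ge> 16"
    by (rule rule[OF P(4) P(5) P(6)]) (use that in linarith | rule 7)+
  have 9: ?P if "n \<ge> 12"
    by (rule rule[OF P(2) P(3) P(4)]) (use that in linarith | rule 8)+
  show ?P
    by (rule rule[OF P(1) P(2) P(3)]) (use assms in linarith | rule 9)+
qed

section \<open>Euler products\<close>

text \<open>The indices left in the Dirichlet series after sieving by the primes up to
  \<open>k\<close>; \<open>rough 0\<close> is the set of all positive integers.\<close>

definition rough :: "nat \<Rightarrow> nat set" where
  "rough k = {n. n > 0 \<and> (\<forall>p. prime p \<and> p \<le> k \<longrightarrow> \<not> p dvd n)}"

definition partial_euler :: "real \<Rightarrow> nat \<Rightarrow> nat \<Rightarrow> real" where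
  "partial_euler r k N = (\<Prod>p\<in>{p. prime p \<and> k < p \<and> p \<le> N}. 1 - real p powr -r)"

text \<open>The infinite product over the primes beyond \<open>k\<close>, encoded as a quotient so
  that no infinite product has to be handled; \<open>partial_euler_tendsto_euler_tail\<close>
  identifies it as the limit of the finite products.\<close>

definition euler_tail :: "real \<Rightarrow> nat \<Rightarrow> real" where
  "euler_tail r k = 1 / (zeta r * partial_euler r 0 k)"

lemma prime_powr_neg_bounds:
  fixes p :: nat
  assumes "r > 1" "prime p"
  shows "real p powr -r > 0" "real p powr -r < 1 / real p" "real p powr -r < 1 / 2"
proof -
  have p: "real p \<ge> 2" using prime_ge_2_nat[OF assms(2)] by simp
  show "real p powr -r > 0" using p by simp
  have "real p powr -r < real p powr (-1)" using assms p by (intro powr_less_mono) auto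
  then show 1: "real p powr -r < 1 / real p" using p by (simp add: powr_minus_divide)
  have "1 / real p \<le> 1 / 2" using p by (intro divide_left_mono) auto
  with 1 show "real p powr -r < 1 / 2" by linarith
qed

lemma partial_euler_factor_bounds:
  fixes p :: nat
  assumes "r > 1" "prime p"
  shows "0 < 1 - real p powr -r" "1 - real p powr -r < 1"
  using prime_powr_neg_bounds[OF assms] by auto

lemma partial_euler_pos:
  assumes "r > 1" shows "partial_euler r k N > 0"
  unfolding partial_euler_def using partial_euler_factor_bounds[OF assms] by (intro prod_pos) auto

lemma partial_euler_le_1:
  assumes "r > 1" shows "partial_euler r k N \<le> 1"
  unfolding partial_euler_def using partial_euler_factor_bounds[OF assms] by (intro prod_le_1) (auto intro: less_imp_le)

lemma partial_euler_split:
  assumes "k \<le> m" "m \<le> N"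
  shows "partial_euler r k N = partial_euler r k m * partial_euler r m N"
proof -
  have "{p. prime p \<and> k < p \<and> p \<le> N} = {p. prime p \<and> k < p \<and> p \<le> m} \<union> {p. prime p \<and> m < p \<and> p \<le> N}"
    using assms by auto
  then show ?thesis
    unfolding partial_euler_def by (subst prod.union_disjoint[symmetric]) auto
qed

lemma partial_euler_Suc:
  "partial_euler r k (Suc k) = (if prime (Suc k) then 1 - real (Suc k) powr -r else 1)"
proof -
  have "{p. prime p \<and> k < p \<and> p \<le> Suc k} = (if prime (Suc k) then {Suc k} else {})"
    by (auto simp: le_Suc_eq)
  then show ?thesis by (simp add: partial_euler_def)
qed

section \<open>Sieving the Dirichlet series\<close>

lemma summable_on_powr_neg:
  assumes "r > 1" shows "(\<lambda>n::nat. real n powr -r) summable_on A"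
proof -
  have "summable (\<lambda>n::nat. real n powr -r)" using assms by (simp add: summable_real_powr_iff)
  then have "(\<lambda>n::nat. real n powr -r) summable_on UNIV"
    by (intro summable_nonneg_imp_summable_on) auto
  then show ?thesis by (rule summable_on_subset_banach) auto
qed

lemma zeta_summable:
  assumes "r > 1" shows "summable (\<lambda>n. 1 / real (Suc n) powr r)"
proof -
  have "summable (\<lambda>n::nat. real n powr -r)" using assms by (simp add: summable_real_powr_iff)
  then have "summable (\<lambda>n::nat. real (Suc n) powr -r)" by (subst summable_Suc_iff)
  then show ?thesis by (simp add: powr_minus_divide)
qed

lemma zeta_eq_infsum:
  assumes "r > 1" shows "zeta r = infsum (\<lambda>n::nat. real n powr -r) (rough 0)"
proof -
  have "(\<lambda>n. 1 / real (Suc n) powr r) sums zeta r"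
    unfolding zeta_def using zeta_summable[OF assms] by (rule summable_sums)
  then have "((\<lambda>n. 1 / real (Suc n) powr r) has_sum zeta r) UNIV"
    by (intro sums_nonneg_imp_has_sum) auto
  then have "(((\<lambda>n::nat. real n powr -r) \<circ> Suc) has_sum zeta r) UNIV"
    by (simp add: o_def powr_minus_divide)
  then have "((\<lambda>n::nat. real n powr -r) has_sum zeta r) (range Suc)"
    by (subst has_sum_reindex) auto
  also have "range Suc = rough 0"
    by (auto simp: rough_def image_iff gr0_conv_Suc)
  finally show ?thesis by (simp add: infsumI)
qed

text \<open>One sieve step: an element of \<open>rough k\<close> either avoids the prime
  \<open>Suc k\<close> or is \<open>Suc k\<close> times an element of \<open>rough k\<close>, whose
  factor may again contain \<open>Suc k\<close>.\<close>

lemma rough_Suc_prime: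
  assumes "prime (Suc k)"
  shows "rough k = rough (Suc k) \<union> (\<lambda>m. Suc k * m) ` rough k"
    and "rough (Suc k) \<inter> (\<lambda>m. Suc k * m) ` rough k = {}"
proof -
  show "rough (Suc k) \<inter> (\<lambda>m. Suc k * m) ` rough k = {}"
    using assms by (auto simp: rough_def simp del: mult_Suc)
  have "Suc k * m \<in> rough k" if "m \<in> rough k" for m
  proof -
    have "\<not> p dvd Suc k * m" if "prime p" "p \<le> k" for p
      using that \<open>m \<in> rough k\<close> assms primes_dvd_imp_eq[of p "Suc k"]
      by (auto simp: rough_def prime_dvd_mult_iff simp del: mult_Suc)
    then show ?thesis using that by (auto simp: rough_def simp del: mult_Suc)
  qed
  moreover have "n \<in> rough (Suc k) \<union> (\<lambda>m. Suc k * m) ` rough k" if "n \<in> rough k" for n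
  proof (cases "Suc k dvd n")
    case True
    then obtain m where m: "n = Suc k * m" by (elim dvdE)
    then have "m \<in> rough k" using that by (auto simp: rough_def simp del: mult_Suc)
    then show ?thesis using m by blast
  next
    case False
    then show ?thesis using that by (auto simp: rough_def le_Suc_eq)
  qed
  moreover have "rough (Suc k) \<subseteq> rough k" by (auto simp: rough_def)
  ultimately show "rough k = rough (Suc k) \<union> (\<lambda>m. Suc k * m) ` rough k" by blast
qed

text \<open>Euler's sieve: multiplying the series by \<open>1 - q powr -r\<close> for the next prime
  \<open>q\<close> removes exactly the terms with index divisible by \<open>q\<close>.\<close>

lemma zeta_mult_partial_euler:
  assumes "r > 1"
  shows "zeta r * partial_euler r 0 k = infsum (\<lambda>n::nat. real n powr -r) (rough k)"
proof (induction k)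
  case 0
  then show ?case using zeta_eq_infsum[OF assms] by (simp add: partial_euler_def)
next
  case (Suc k)
  let ?f = "\<lambda>n::nat. real n powr -r"
  have split: "partial_euler r 0 (Suc k) = partial_euler r 0 k * partial_euler r k (Suc k)"
    by (intro partial_euler_split) auto
  show ?case
  proof (cases "prime (Suc k)")
    case True
    have "infsum ?f (rough k) = infsum ?f (rough (Suc k)) + infsum ?f ((\<lambda>m. Suc k * m) ` rough k)"
      by (subst rough_Suc_prime(1)[OF True], intro infsum_Un_disjoint summable_on_powr_neg assms
          rough_Suc_prime(2)[OF True])
    also have "infsum ?f ((\<lambda>m. Suc k * m) ` rough k) = infsum (?f \<circ> (\<lambda>m. Suc k * m)) (rough k)"
      by (intro infsum_reindex inj_onI) (simp del: mult_Suc)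
    also have "?f \<circ> (\<lambda>m. Suc k * m) = (\<lambda>m. ?f (Suc k) * ?f m)"
      by (auto simp: powr_mult simp del: mult_Suc of_nat_Suc)
    also have "infsum \<dots> (rough k) = ?f (Suc k) * infsum ?f (rough k)"
      by (intro infsum_cmult_right summable_on_powr_neg assms)
    finally have "infsum ?f (rough (Suc k)) = infsum ?f (rough k) * (1 - ?f (Suc k))"
      by (simp add: algebra_simps)
    then show ?thesis using Suc split True by (simp add: partial_euler_Suc)
  next
    case False
    then have "rough (Suc k) = rough k" by (auto simp: rough_def le_Suc_eq)
    then show ?thesis using Suc split False by (simp add: partial_euler_Suc)
  qed
qed

lemma zeta_mult_partial_euler_ge_1:
  assumes "r > 1"
  shows "zeta r * partial_euler r 0 k \<ge> 1"
proof -
  have "infsum (\<lambda>n::nat. real n powr -r) {1} \<le> infsum (\<lambda>n::nat. real n powr -r) (rough k)"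
    by (intro infsum_mono2 summable_on_powr_neg assms) (auto simp: rough_def)
  then show ?thesis using zeta_mult_partial_euler[OF assms] by simp
qed

lemma zeta_mult_partial_euler_tendsto:
  assumes "r > 1"
  shows "(\<lambda>k. zeta r * partial_euler r 0 k) \<longlonglongrightarrow> 1"
proof (rule tendsto_sandwich)
  let ?f = "\<lambda>n::nat. real n powr -r"
  show "\<forall>\<^sub>F k in sequentially. 1 \<le> zeta r * partial_euler r 0 k"
    using zeta_mult_partial_euler_ge_1[OF assms] by auto
  have summ: "summable ?f" using assms by (simp add: summable_real_powr_iff)
  show "\<forall>\<^sub>F k in sequentially. zeta r * partial_euler r 0 k \<le> 1 + (suminf ?f - (\<Sum>n<Suc k. ?f n))"
  proof (intro always_eventually allI)
    fix k
    have f_tail: "infsum ?f {Suc k..} = suminf ?f - (\<Sum>n<Suc k. ?f n)"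
    proof -
      have "(?f has_sum suminf ?f) UNIV"
        using summ by (intro sums_nonneg_imp_has_sum summable_sums) auto
      moreover have "infsum ?f ({..<Suc k} \<union> {Suc k..}) = infsum ?f {..<Suc k} + infsum ?f {Suc k..}"
        by (intro infsum_Un_disjoint summable_on_powr_neg assms) auto
      moreover have "{..<Suc k} \<union> {Suc k..} = UNIV" by auto
      ultimately show ?thesis by (simp add: infsumI del: sum.lessThan_Suc)
    qed
    \<comment> \<open>A rough number other than 1 has a prime factor beyond \<open>k\<close> and
      hence exceeds \<open>k\<close> itself. So the sieved series is at most 1 plus a tail of a
      convergent series.\<close>
    have "rough k \<subseteq> {1} \<union> {Suc k..}"
    proof
      fix n assume n: "n \<in> rough k"
      show "n \<in> {1} \<union> {Suc k..}"
      proof (cases "n = 1")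
        case False
        then obtain p where p: "prime p" "p dvd n" using prime_factor_nat by blast
        then have "p \<le> n" using n by (auto simp: rough_def intro: dvd_imp_le)
        then show ?thesis using p n by (force simp: rough_def)
      qed auto
    qed
    then have "infsum ?f (rough k) \<le> infsum ?f ({1} \<union> {Suc k..})"
      by (intro infsum_mono2 summable_on_powr_neg assms) auto
    also have "\<dots> \<le> infsum ?f {1} + infsum ?f {Suc k..}"
    \<comment> \<open>For \<open>k = 0\<close> the two sets overlap in 1, so only the inequality
      holds there.\<close>
    proof (cases "k = 0")
      case True
      then have "{1} \<union> {Suc k..} = {Suc k..}" by auto
      then show ?thesis by simp
    next
      case False
      then show ?thesis
        by (intro eq_refl infsum_Un_disjoint summable_on_powr_neg assms) auto
    qed
    finally show "zeta r * partial_euler r 0 k \<le> 1 + (suminf ?f - (\<Sum>n<Suc k. ?f n))"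
      using f_tail zeta_mult_partial_euler[OF assms] by simp
  qed
  have "(\<lambda>k. \<Sum>n<Suc k. ?f n) \<longlonglongrightarrow> suminf ?f"
    using summable_LIMSEQ[OF summ] by (rule LIMSEQ_Suc)
  then have "(\<lambda>k. 1 + (suminf ?f - (\<Sum>n<Suc k. ?f n))) \<longlonglongrightarrow> 1 + (suminf ?f - suminf ?f)"
    by (intro tendsto_intros)
  then show "(\<lambda>k. 1 + (suminf ?f - (\<Sum>n<Suc k. ?f n))) \<longlonglongrightarrow> 1" by simp
qed auto

section \<open>Tails of the Euler product\<close>

lemma zeta_pos:
  assumes "r > 1" shows "zeta r > 0"
  using zeta_mult_partial_euler_ge_1[OF assms, of 0] by (simp add: partial_euler_def)

lemma euler_tail_pos: "r > 1 \<Longrightarrow> euler_tail r k > 0"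
  by (simp add: euler_tail_def zeta_pos partial_euler_pos)

lemma euler_tail_le_1: "r > 1 \<Longrightarrow> euler_tail r k \<le> 1"
  using zeta_mult_partial_euler_ge_1[of r k] by (simp add: euler_tail_def)

lemma euler_tail_0: "euler_tail r 0 = 1 / zeta r"
  by (simp add: euler_tail_def partial_euler_def)

lemma euler_tail_tendsto:
  assumes "r > 1" shows "euler_tail r \<longlonglongrightarrow> 1"
  unfolding euler_tail_def
  using tendsto_divide[OF tendsto_const zeta_mult_partial_euler_tendsto[OF assms], of 1] by simp

lemma euler_tail_split:
  assumes "r > 1" "k \<le> N"
  shows "euler_tail r k = partial_euler r k N * euler_tail r N"
  using partial_euler_split[of 0 k N r] partial_euler_pos[OF assms(1)] zeta_pos[OF assms(1)] assms
  by (simp add: euler_tail_def less_imp_neq[symmetric])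

lemma euler_tail_le_partial_euler:
  assumes "r > 1" "k \<le> N"
  shows "euler_tail r k \<le> partial_euler r k N"
  using euler_tail_split[OF assms] partial_euler_pos[of r k N] euler_tail_le_1[of r N] assms
  by (simp add: mult_le_cancel_left2)

lemma partial_euler_tendsto_euler_tail:
  assumes "r > 1"
  shows "(\<lambda>N. partial_euler r k N) \<longlonglongrightarrow> euler_tail r k"
proof -
  have "(\<lambda>N. euler_tail r k / euler_tail r N) \<longlonglongrightarrow> euler_tail r k / 1"
    by (intro tendsto_intros euler_tail_tendsto assms) auto
  moreover have "\<forall>\<^sub>F N in sequentially. euler_tail r k / euler_tail r N = partial_euler r k N"
    using eventually_ge_at_top[of k]
  proof eventually_elim
    case (elim N)
    then show ?case
      using euler_tail_split[OF assms elim] euler_tail_pos[OF assms, of N] by simp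
  qed
  ultimately show ?thesis by (auto dest: tendsto_cong)
qed

text \<open>The series at \<open>a\<close> dominates the series on the whole interval. Continuity
  serves the intermediate value theorem that produces \<open>eta_A\<close>.\<close>

lemma zeta_continuous_on:
  assumes "a > 1" shows "continuous_on {a..b} zeta"
proof -
  have "uniform_limit {a..b} (\<lambda>n r. \<Sum>i<n. 1 / real (Suc i) powr r)
      (\<lambda>r. \<Sum>i. 1 / real (Suc i) powr r) sequentially"
  proof (rule Weierstrass_m_test)
    show "summable (\<lambda>n. 1 / real (Suc n) powr a)" using assms by (rule zeta_summable)
    show "norm (1 / real (Suc n) powr r) \<le> 1 / real (Suc n) powr a" if "r \<in> {a..b}" for n r
      using that by (auto intro!: divide_left_mono powr_mono)
  qed
  then have "continuous_on {a..b} (\<lambda>r. \<Sum>i. 1 / real (Suc i) powr r)"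
    by (rule uniform_limit_theorem[rotated]) (auto intro!: always_eventually continuous_intros)
  then show ?thesis by (simp add: zeta_def[abs_def])
qed

lemma partial_euler_0_3: "partial_euler r 0 3 = (1 - 2 powr -r) * (1 - 3 powr -r)"
proof -
  have "{p::nat. prime p \<and> 0 < p \<and> p \<le> 3} = {2, 3}"
  proof -
    have "p = 2 \<or> p = 3" if "prime p" "p \<le> 3" for p :: nat
      using prime_ge_2_nat[OF that(1)] that(2) by auto
    then show ?thesis by auto
  qed
  then show ?thesis by (simp add: partial_euler_def)
qed

section \<open>Monotonicity of the gap at 3\<close>

text \<open>The value of \<open>s_fun (-r)\<close> at 9, which is the lower end of the possible
  gap.\<close>

definition gap_start :: "real \<Rightarrow> real" where
  "gap_start r = 1 - 3 powr -r + 3 powr (-2 * r)"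

lemma three_powr_bounds: "r > 1 \<Longrightarrow> 0 < (3::real) powr -r \<and> (3::real) powr -r < 1/3"
  using powr_less_mono[of "-r" "-1" "3::real"] by (simp add: powr_minus_divide)

lemma two_powr_bounds: "r > 1 \<Longrightarrow> 0 < (2::real) powr -r \<and> (2::real) powr -r < 1/2"
  using powr_less_mono[of "-r" "-1" "2::real"] by (simp add: powr_minus_divide)

lemma gap_start_eq: "gap_start r = 1 - 3 powr -r + (3 powr -r)\<^sup>2"
  by (simp add: gap_start_def power2_eq_square flip: powr_add)

text \<open>Dividing the defining equation by its first two factors, the Euler factors at 2 and 3,
  leaves the equality of the two ends of the gap.\<close>

lemma is_eta_A_iff:
  "is_eta_A r \<longleftrightarrow> r \<in> {1<..<2} \<and> euler_tail r 3 = gap_start r"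
proof (cases "r > 1")
  case True
  have "(1 - 2 powr (-r)) * (1 - 3 powr (-r)) * gap_start r = 1 / zeta r \<longleftrightarrow>
      euler_tail r 3 = gap_start r"
  proof -
    define M where "M = (1 - 2 powr (-r)) * (1 - 3 powr (-r) :: real)"
    have "M > 0"
      using three_powr_bounds[OF True] two_powr_bounds[OF True] by (simp add: M_def)
    then have "1 / (zeta r * M) = gap_start r \<longleftrightarrow> 1 / zeta r = gap_start r * M"
      using nonzero_divide_eq_eq[of M "1 / zeta r" "gap_start r"] by simp
    then show ?thesis
      unfolding euler_tail_def partial_euler_0_3 M_def[symmetric] by (metis mult.commute)
  qed
  then show ?thesis by (simp add: is_eta_A_def gap_start_def)
qed (auto simp: is_eta_A_def)

text \<open>Convexity of \<open>exp\<close> on the segment from 0 to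
  \<open>ln (1 - y)\<close>.\<close>

lemma Bernoulli_powr_le:
  fixes t y :: real
  assumes "0 \<le> t" "t \<le> 1" "y < 1"
  shows "(1 - y) powr t \<le> 1 - t * y"
proof -
  have "exp ((1 - t) *\<^sub>R 0 + t *\<^sub>R ln (1 - y)) \<le> (1 - t) * exp 0 + t * exp (ln (1 - y))"
    using assms by (intro convex_onD[OF exp_convex]) auto
  then show ?thesis using assms by (simp add: powr_def algebra_simps)
qed

text \<open>Passing from \<open>r\<close> to \<open>r'\<close> multiplies each \<open>p powr -r\<close> with \<open>p > k\<close> by at most
  \<open>(k + 1) powr (r - r')\<close>. Bernoulli's inequality moves this factor into the exponent.\<close>

lemma partial_euler_powr_le:
  assumes "r > 1" "r \<le> r'"
  shows "partial_euler r k N powr (real (Suc k) powr (r - r')) \<le> partial_euler r' k N"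
proof -
  define t where "t = real (Suc k) powr (r - r')"
  have "partial_euler r k N powr t = (\<Prod>p\<in>{p. prime p \<and> k < p \<and> p \<le> N}. (1 - real p powr -r) powr t)"
    unfolding partial_euler_def by (rule prod_powr_distrib)
  also have "\<dots> \<le> partial_euler r' k N"
    unfolding partial_euler_def
  proof (intro prod_mono conjI)
    fix p assume "p \<in> {p. prime p \<and> k < p \<and> p \<le> N}"
    then have p: "prime p" "k < p" by auto
    have "t \<le> real 1 powr (r - r')"
      unfolding t_def using assms by (intro powr_mono2') auto
    then have "t \<le> 1" by simp
    then have "(1 - real p powr -r) powr t \<le> 1 - t * real p powr -r"
      using prime_powr_neg_bounds[OF assms(1) p(1)] by (intro Bernoulli_powr_le) (auto simp: t_def)
    moreover have "real p powr (r - r') \<le> t"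
      unfolding t_def using assms p by (intro powr_mono2') auto
    then have "real p powr (r - r') * real p powr -r \<le> t * real p powr -r"
      by (intro mult_right_mono) auto
    moreover have "real p powr (r - r') * real p powr -r = real p powr -r'"
      using powr_add[of "real p" "r - r'" "-r"] by simp
    ultimately show "(1 - real p powr -r) powr t \<le> 1 - real p powr -r'" by linarith
  qed auto
  finally show ?thesis by (simp add: t_def)
qed

lemma euler_tail_powr_le:
  assumes "r > 1" "r \<le> r'"
  shows "euler_tail r k powr (real (Suc k) powr (r - r')) \<le> euler_tail r' k"
proof (rule LIMSEQ_le)
  show "(\<lambda>N. partial_euler r k N powr (real (Suc k) powr (r - r')))
      \<longlonglongrightarrow> euler_tail r k powr (real (Suc k) powr (r - r'))"
    using euler_tail_pos[OF assms(1)]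
    by (intro tendsto_powr partial_euler_tendsto_euler_tail assms tendsto_const) (auto simp: less_imp_neq[symmetric])
  show "(\<lambda>N. partial_euler r' k N) \<longlonglongrightarrow> euler_tail r' k"
    using assms by (intro partial_euler_tendsto_euler_tail) auto
qed (use partial_euler_powr_le[OF assms] in auto)

lemma ln_quadratic_div_mono:
  fixes x y :: real
  assumes "0 < x" "x \<le> y" "y < 1"
  shows "ln (1 - x + x\<^sup>2) / x \<le> ln (1 - y + y\<^sup>2) / y"
proof (rule DERIV_nonneg_imp_nondecreasing[OF assms(2)])
  fix z assume "x \<le> z" "z \<le> y"
  then have z: "0 < z" "z < 1" using assms by auto
  define g where "g = 1 - z + z\<^sup>2"
  have g: "g > 0" using z by (simp add: g_def add_pos_nonneg)
  have "((\<lambda>z. ln (1 - z + z\<^sup>2) / z) has_real_derivative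
      ((2 * z - 1) / g * z - ln g * 1) / (z * z)) (at z)"
    using z g by (auto intro!: derivative_eq_intros simp: g_def)
  moreover have "ln g \<le> (2 * z - 1) / g * z"
  proof -
    have "(z - 1) * g = 2 * z - 1 - z\<^sup>2 * (2 - z)"
      by (simp add: g_def algebra_simps power2_eq_square power3_eq_cube)
    also have "\<dots> \<le> 2 * z - 1" using z by simp
    finally have "z - 1 \<le> (2 * z - 1) / g" using g by (simp add: pos_le_divide_eq)
    then have "(z - 1) * z \<le> (2 * z - 1) / g * z" using z by (intro mult_right_mono) auto
    moreover have "ln g \<le> (z - 1) * z"
      using ln_le_minus_one[OF g] by (simp add: g_def algebra_simps power2_eq_square)
    ultimately show ?thesis by linarith
  qed
  ultimately show "\<exists>D. ((\<lambda>z. ln (1 - z + z\<^sup>2) / z) has_real_derivative D) (at z) \<and> 0 \<le> D"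
    using z by (intro exI conjI) auto
qed

lemma gap_start_pos: "gap_start r > 0"
proof -
  have "(1 - 3 powr -r / 2)\<^sup>2 + 3 / 4 * (3 powr -r)\<^sup>2 > (0::real)"
    by (intro add_nonneg_pos) auto
  then show ?thesis by (simp add: gap_start_eq power2_eq_square algebra_simps)
qed

text \<open>Passing from \<open>r\<close> to \<open>r'\<close> multiplies \<open>3 powr -r\<close>
  by \<open>s = 3 powr (r - r')\<close>; by \<open>ln_quadratic_div_mono\<close>, the logarithm of
  \<open>gap_start\<close> becomes at most \<open>s\<close> times the old one.\<close>

lemma gap_start_powr_ge:
  assumes "r > 1" "r \<le> r'"
  shows "gap_start r' \<le> gap_start r powr (3 powr (r - r'))"
proof -
  define y where "y = (3::real) powr -r"
  define s where "s = (3::real) powr (r - r')"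
  have y: "0 < y" "y < 1" using three_powr_bounds[OF assms(1)] by (auto simp: y_def)
  have s: "0 < s" "s \<le> 1" using assms powr_mono[of "r - r'" 0 "3::real"] by (auto simp: s_def)
  have y': "3 powr -r' = s * y" using powr_add[of "3::real" "r - r'" "-r"] by (simp add: y_def s_def)
  have "ln (gap_start r') / (s * y) \<le> ln (gap_start r) / y"
    unfolding gap_start_eq y' y_def[symmetric]
    using y s by (intro ln_quadratic_div_mono) auto
  then have "ln (gap_start r') \<le> s * ln (gap_start r)"
    using y s by (simp add: field_simps)
  also have "\<dots> = ln (gap_start r powr s)"
    using gap_start_pos[of r] by (simp add: ln_powr)
  finally show ?thesis
    using gap_start_pos[of r] gap_start_pos[of r'] by (subst (asm) ln_le_cancel_iff) (auto simp: s_def)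
qed

text \<open>The negative logarithm of the tail shrinks at least by the factor
  \<open>4 powr (r - r')\<close>, that of \<open>gap_start\<close> at most by
  \<open>3 powr (r - r')\<close>. The larger base wins, so the tail stays above, now
  strictly.\<close>

lemma euler_tail_gt_gap_start:
  assumes "1 < r" "r < r'" "gap_start r \<le> euler_tail r 3"
  shows "gap_start r' < euler_tail r' 3"
proof -
  \<comment> \<open>The prime 5 alone pushes the tail below 1, which makes its powers strictly
    decreasing in the exponent.\<close>
  have F1: "euler_tail r 3 < 1"
  proof -
    have "euler_tail r 3 \<le> partial_euler r 3 4 * partial_euler r 4 (Suc 4)"
      using euler_tail_le_partial_euler[of r 3 "Suc 4"] partial_euler_split[of 3 4 "Suc 4" r] assms
      by simp
    also have "\<dots> \<le> 1 * partial_euler r 4 (Suc 4)"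
      using assms by (intro mult_right_mono partial_euler_le_1 less_imp_le[OF partial_euler_pos])
    also have "\<dots> < 1" using partial_euler_Suc[of r 4] by simp
    finally show ?thesis .
  qed
  have "gap_start r' \<le> gap_start r powr (3 powr (r - r'))"
    using assms by (intro gap_start_powr_ge) auto
  also have "\<dots> \<le> euler_tail r 3 powr (3 powr (r - r'))"
    using assms gap_start_pos[of r] by (intro powr_mono2) auto
  also have "\<dots> < euler_tail r 3 powr (4 powr (r - r'))"
  proof (rule powr_less_mono')
    show "(4::real) powr (r - r') < 3 powr (r - r')"
      using assms by (intro powr_less_mono2_neg) auto
  qed (use euler_tail_pos F1 assms in auto)
  also have "\<dots> \<le> euler_tail r' 3"
    using euler_tail_powr_le[of r r' 3] assms by simp
  finally show ?thesis .
qed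

section \<open>The gap condition for exponents up to 2\<close>

lemma partial_euler_le_prod_subset:
  assumes "r > 1" "S \<subseteq> {p. prime p \<and> k < p \<and> p \<le> N}"
  shows "partial_euler r k N \<le> (\<Prod>p\<in>S. 1 - real p powr -r)"
proof -
  let ?T = "{p. prime p \<and> k < p \<and> p \<le> N}"
  have fin: "finite ?T" by simp
  have b: "0 < 1 - real p powr -r \<and> 1 - real p powr -r < 1" if "p \<in> ?T" for p
    using partial_euler_factor_bounds[OF assms(1)] that by auto
  have "partial_euler r k N = (\<Prod>p\<in>?T - S. 1 - real p powr -r) * (\<Prod>p\<in>S. 1 - real p powr -r)"
    unfolding partial_euler_def using fin assms by (intro prod.subset_diff) auto
  also have "\<dots> \<le> 1 * (\<Prod>p\<in>S. 1 - real p powr -r)"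
    using b assms(2)
    by (intro mult_right_mono prod_le_1 prod_nonneg ballI) (force intro: less_imp_le)+
  finally show ?thesis by simp
qed

text \<open>The factors satisfy \<open>1 - u \<le> exp (- u)\<close>, so the tail is at most
  \<open>exp (- c)\<close>, while \<open>1 + c \<le> exp c\<close>.\<close>

lemma euler_tail_le_sum:
  assumes "r > 1" "finite S" "\<And>p. p \<in> S \<Longrightarrow> prime p \<and> k < p" "0 \<le> c" "c \<le> (\<Sum>p\<in>S. real p powr -r)"
  shows "euler_tail r k * (1 + c) \<le> 1"
proof -
  define N where "N = k + \<Sum>S"
  have "p \<le> N" if "p \<in> S" for p
    using that assms(2) member_le_sum[of p S "\<lambda>p. p"] by (simp add: N_def trans_le_add2)
  then have "S \<subseteq> {p. prime p \<and> k < p \<and> p \<le> N}" using assms(3) by auto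
  then have "euler_tail r k \<le> (\<Prod>p\<in>S. 1 - real p powr -r)"
    using euler_tail_le_partial_euler[of r k N] partial_euler_le_prod_subset[of r S k N] assms(1)
    by (simp add: N_def)
  also have "\<dots> \<le> (\<Prod>p\<in>S. exp (- (real p powr -r)))"
  proof (intro prod_mono conjI)
    fix p assume "p \<in> S"
    then show "0 \<le> 1 - real p powr -r"
      using assms partial_euler_factor_bounds[of r p] by (auto intro: less_imp_le)
    show "1 - real p powr -r \<le> exp (- (real p powr -r))"
      using exp_ge_add_one_self[of "- (real p powr -r)"] by simp
  qed
  also have "\<dots> = exp (- (\<Sum>p\<in>S. real p powr -r))"
    using assms(2) by (simp add: exp_sum sum_negf flip: sum_negf)
  also have "\<dots> \<le> exp (- c)" using assms by simp
  finally have "euler_tail r k * (1 + c) \<le> exp (- c) * exp c"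
    using assms euler_tail_pos[of r k] exp_ge_add_one_self[of c] by (intro mult_mono) auto
  then show ?thesis by (simp flip: exp_add)
qed

lemma euler_tail_le_ratio_sum:
  assumes "r > 1" "finite S" "k > 0" "\<And>p. p \<in> S \<Longrightarrow> prime p \<and> k < p"
    and "0 \<le> c" "c \<le> (\<Sum>p\<in>S. (real k / real p) powr r)"
  shows "euler_tail r k * (1 + c * real k powr -r) \<le> 1"
proof (rule euler_tail_le_sum[OF assms(1,2,4)])
  have "c * real k powr -r \<le> (\<Sum>p\<in>S. (real k / real p) powr r) * real k powr -r"
    using assms by (intro mult_right_mono) auto
  also have "\<dots> = (\<Sum>p\<in>S. real p powr -r)"
    unfolding sum_distrib_right
    using assms(3) by (intro sum.cong refl) (simp add: powr_divide powr_minus field_simps)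
  finally show "c * real k powr -r \<le> (\<Sum>p\<in>S. real p powr -r)" .
qed (use assms in auto)

text \<open>Because \<open>(1 - x + x\<^sup>2) * (1 + x) = 1 + x ^ 3\<close>. With
  \<open>x = real q powr -r\<close> this reduces the gap condition at \<open>q\<close> to finding
  primes beyond \<open>q\<close> whose ratios \<open>(q / p) powr r\<close> add up to at least
  1.\<close>

lemma inverse_le_quadratic:
  fixes x R :: real
  assumes "R * (1 + x) \<le> 1" "x > 0"
  shows "R \<le> 1 - x + x\<^sup>2"
proof -
  have "(1 - x + x\<^sup>2) * (1 + x) = 1 + x ^ 3"
    by (simp add: algebra_simps power2_eq_square power3_eq_cube)
  then have "R * (1 + x) \<le> (1 - x + x\<^sup>2) * (1 + x)"
    using assms zero_less_power[of x 3] by linarith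
  then show ?thesis using assms by (simp add: mult_le_cancel_right)
qed

text \<open>Each of the three primes between \<open>2 ^ K * q\<close> and \<open>2 ^ (K + 1) * q\<close> contributes at least
  \<open>1 / 4 ^ (K + 1)\<close>.\<close>

lemma sum_ratio_squares_ge:
  fixes q :: nat
  assumes "q \<ge> 10"
  shows "(\<Sum>p\<in>{p. prime p \<and> q < p \<and> p \<le> 2 ^ K * q}. (real q / real p)\<^sup>2) \<ge> 1 - (1/4) ^ K"
proof (induction K)
  case (Suc K)
  let ?n = "2 ^ K * q"
  let ?A = "{p. prime p \<and> q < p \<and> p \<le> ?n}" and ?B = "{p. prime p \<and> ?n < p \<and> p \<le> 2 * ?n}"
  have "q \<le> ?n" by simp
  then have "q < p" if "?n < p" for p using that by (rule le_less_trans)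
  then have "{p. prime p \<and> q < p \<and> p \<le> 2 ^ Suc K * q} = ?A \<union> ?B" by auto
  moreover have "?A \<inter> ?B = {}" by auto
  ultimately have "(\<Sum>p\<in>{p. prime p \<and> q < p \<and> p \<le> 2 ^ Suc K * q}. (real q / real p)\<^sup>2) =
      (\<Sum>p\<in>?A. (real q / real p)\<^sup>2) + (\<Sum>p\<in>?B. (real q / real p)\<^sup>2)"
    by (simp add: sum.union_disjoint)
  moreover have "(\<Sum>p\<in>?B. (real q / real p)\<^sup>2) \<ge> 3 * (1/4) ^ Suc K"
  proof -
    have "3 * (1/4) ^ Suc K \<le> real (card ?B) * (1/4) ^ Suc K"
      using card_primes_between_double_ge_3[of ?n] assms \<open>q \<le> ?n\<close> by (intro mult_right_mono) auto
    also have "\<dots> = (\<Sum>p\<in>?B. (1/4) ^ Suc K)" by simp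
    also have "\<dots> \<le> (\<Sum>p\<in>?B. (real q / real p)\<^sup>2)"
    proof (rule sum_mono)
      fix p assume "p \<in> ?B"
      then have p: "p > 0" "p \<le> 2 ^ Suc K * q" by auto
      then have "real p \<le> 2 ^ Suc K * real q"
        using of_nat_mono[of p "2 ^ Suc K * q", where 'a = real] by simp
      then have "(1/2) ^ Suc K \<le> real q / real p"
        using p by (simp add: field_simps)
      then have "((1/2) ^ Suc K)\<^sup>2 \<le> (real q / real p)\<^sup>2"
        by (intro power_mono) auto
      moreover have "((1/2) ^ Suc K)\<^sup>2 = (1/4 :: real) ^ Suc K"
        by (simp add: power2_eq_square flip: power_mult_distrib)
      ultimately show "(1/4) ^ Suc K \<le> (real q / real p)\<^sup>2" by (simp only:)
    qed
    finally show ?thesis .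
  qed
  ultimately show ?case using Suc by simp
qed (simp add: sum_nonneg)

text \<open>The ratios \<open>k / p\<close> are below 1, so among the exponents up to 2 the exponent
  2 is the worst case.\<close>

lemma euler_tail_le_ratio_squares:
  assumes "1 < r" "r \<le> 2" "finite S" "k > 0" "\<And>p. p \<in> S \<Longrightarrow> prime p \<and> k < p"
    and "0 \<le> c" "c \<le> (\<Sum>p\<in>S. (real k / real p)\<^sup>2)"
  shows "euler_tail r k * (1 + c * real k powr -r) \<le> 1"
proof (rule euler_tail_le_ratio_sum[OF assms(1,3-6)])
  have "(\<Sum>p\<in>S. (real k / real p)\<^sup>2) \<le> (\<Sum>p\<in>S. (real k / real p) powr r)"
  proof (rule sum_mono)
    fix p assume "p \<in> S"
    then have p: "k < p" using assms by auto
    have "(real k / real p)\<^sup>2 = (real k / real p) powr 2"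
      using p assms(4) by simp
    also have "\<dots> \<le> (real k / real p) powr r"
      using p assms(2,4) by (intro powr_mono') auto
    finally show "(real k / real p)\<^sup>2 \<le> (real k / real p) powr r" .
  qed
  then show "c \<le> (\<Sum>p\<in>S. (real k / real p) powr r)" using assms by linarith
qed

text \<open>The tail at 2 is \<open>(1 - y)\<close> times the tail at 3, hence at most
  \<open>(1 - y) * (1 - y + y\<^sup>2)\<close>; from \<open>r \<le> 2\<close> comes
  \<open>y \<ge> (2/3)\<^sup>2 * x\<close>. What remains is a polynomial inequality in
  \<open>x\<close>.\<close>

lemma gap_condition_2:
  assumes "1 < r" "r \<le> 2" "euler_tail r 3 \<le> gap_start r"
  shows "euler_tail r 2 \<le> 1 - 2 powr -r + (2 powr -r)\<^sup>2"
proof -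
  define x y where "x = (2::real) powr -r" and "y = (3::real) powr -r"
  have x: "1/4 \<le> x" "x < 1/2"
    using two_powr_bounds[OF assms(1)] powr_mono[of "-2" "-r" "2::real"] assms
    by (auto simp: x_def powr_minus_divide)
  have y: "0 < y" "y < 1/3" using three_powr_bounds[OF assms(1)] by (auto simp: y_def)
  have "4/9 * x \<le> y"
  proof -
    have "(2/3::real) powr 2 \<le> (2/3) powr r" using assms by (intro powr_mono') auto
    then have "4/9 \<le> (2/3::real) powr r" by (simp add: power2_eq_square)
    moreover have "(2/3::real) powr r = y / x"
      by (simp add: x_def y_def powr_divide powr_minus field_simps)
    ultimately show ?thesis using x by (simp add: field_simps)
  qed
  have "euler_tail r 2 = (1 - y) * euler_tail r 3"
    using euler_tail_split[of r 2 3] assms partial_euler_Suc[of r 2] by (simp add: y_def)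
  also have "\<dots> \<le> (1 - y) * (1 - y + y\<^sup>2)"
    using assms y unfolding gap_start_eq y_def by (intro mult_left_mono) auto
  also have "\<dots> \<le> 1 - 2 * (y * (1 - y))"
    using y by (simp add: algebra_simps power2_eq_square)
  \<comment> \<open>The product \<open>t * (1 - t)\<close> grows with \<open>t\<close> below
    1/2.\<close>
  also have "\<dots> \<le> 1 - 2 * (4/9 * x * (1 - 4/9 * x))"
  proof -
    have "0 \<le> (y - 4/9 * x) * (1 - y - 4/9 * x)"
      using \<open>4/9 * x \<le> y\<close> x y by (intro mult_nonneg_nonneg) auto
    then show ?thesis by (simp add: algebra_simps)
  qed
  also have "\<dots> \<le> 1 - x + x\<^sup>2"
  proof -
    \<comment> \<open>This is the difference of the two sides; it is nonnegative because
      \<open>x \<ge> 1/4\<close>.\<close>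
    have "0 \<le> x * (49 / 81 * x - 1 / 9)" using x by (intro mult_nonneg_nonneg) auto
    then show ?thesis by (simp add: algebra_simps power2_eq_square)
  qed
  finally show ?thesis by (simp add: x_def)
qed

lemma gap_condition:
  fixes q :: nat
  assumes "1 < r" "r \<le> 2" "euler_tail r 3 \<le> gap_start r" "prime q"
  shows "euler_tail r q \<le> 1 - real q powr -r + (real q powr -r)\<^sup>2"
proof -
  have x: "real q powr -r > 0" using prime_powr_neg_bounds[OF assms(1,4)] by simp
  have *: "euler_tail r q * (1 + real q powr -r) \<le> 1 \<Longrightarrow> ?thesis"
    using inverse_le_quadratic x by blast
  have q: "q > 0" using assms(4) prime_gt_0_nat by blast
  consider "q = 2" | "q = 3" | "q = 5" | "q = 7" | "q \<ge> 10"
  proof -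
    have "q \<noteq> 0" "q \<noteq> 1" "q \<noteq> 4" "q \<noteq> 6" "q \<noteq> 8" "q \<noteq> 9" using assms(4) by auto
    then have "q = 2 \<or> q = 3 \<or> q = 5 \<or> q = 7 \<or> q \<ge> 10" by presburger
    then show ?thesis using that by blast
  qed
  then show ?thesis
  proof cases
    case 1 then show ?thesis using gap_condition_2[OF assms(1-3)] by simp
  next
    case 2 then show ?thesis using assms(3) by (simp add: gap_start_eq)
  next
    case 3
    \<comment> \<open>Over the five listed primes, the squares of \<open>5 / p\<close> add up to
      about 1.02; for \<open>q = 7\<close> below, the sum is about 1.09.\<close>
    have "euler_tail r q * (1 + 1 * real q powr -r) \<le> 1"
      using assms 3 by (intro euler_tail_le_ratio_squares[of r "{7,11,13,17,19}"])
        (auto simp: power2_eq_square)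
    then show ?thesis using * by simp
  next
    case 4
    have "euler_tail r q * (1 + 1 * real q powr -r) \<le> 1"
      using assms 4 by (intro euler_tail_le_ratio_squares[of r "{11,13,17,19,23}"])
        (auto simp: power2_eq_square)
    then show ?thesis using * by simp
  next
    case 5
    \<comment> \<open>Finitely many dyadic blocks only guarantee \<open>1 - (1/4) ^ K\<close>; the
      constant 1 is reached in the limit.\<close>
    have "euler_tail r q * (1 + (1 - (1/4) ^ K) * real q powr -r) \<le> 1" for K
      by (rule euler_tail_le_ratio_squares[OF assms(1,2) _ q _ _ sum_ratio_squares_ge[OF 5]])
        (auto simp: power_le_one)
    moreover have "(\<lambda>K. euler_tail r q * (1 + (1 - (1/4) ^ K) * real q powr -r))
        \<longlonglongrightarrow> euler_tail r q * (1 + (1 - 0) * real q powr -r)"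
      by (intro tendsto_intros LIMSEQ_power_zero) auto
    ultimately have "euler_tail r q * (1 + (1 - 0) * real q powr -r) \<le> 1"
      by (intro LIMSEQ_le_const2) auto
    then show ?thesis using * by simp
  qed
qed

section \<open>Existence and uniqueness of the threshold\<close>

lemma euler_tail_3_continuous_on:
  assumes "a > 1" shows "continuous_on {a..b} (\<lambda>r. euler_tail r 3)"
proof -
  have "zeta r * ((1 - 2 powr -r) * (1 - 3 powr -r)) \<noteq> 0" if "r \<in> {a..b}" for r
    using that assms zeta_pos[of r] two_powr_bounds[of r] three_powr_bounds[of r] by auto
  then show ?thesis
    unfolding euler_tail_def partial_euler_0_3 using assms
    by (intro continuous_intros zeta_continuous_on) auto
qed

lemma powr_three_halves_ge:
  fixes a x :: real
  assumes "a\<^sup>2 \<le> x ^ 3" "x > 0"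
  shows "a \<le> x powr (3/2)"
proof -
  have "x powr (3/2) = (x powr 3) powr (1/2)" by (simp add: powr_powr)
  also have "\<dots> = sqrt (x ^ 3)" using assms by (simp add: powr_half_sqrt)
  finally show ?thesis using assms by (simp add: real_le_rsqrt)
qed

lemma gap_start_ge_euler_tail_three_halves: "euler_tail (3/2) 3 \<le> gap_start (3/2)"
proof -
  \<comment> \<open>Rational lower bounds for \<open>(3 / p) powr (3/2)\<close> at the primes from 5
    to 17; they add up to 1.06.\<close>
  have "46/100 \<le> (3/5::real) powr (3/2)" "28/100 \<le> (3/7::real) powr (3/2)"
    "14/100 \<le> (3/11::real) powr (3/2)" "11/100 \<le> (3/13::real) powr (3/2)"
    "7/100 \<le> (3/17::real) powr (3/2)"
    by (rule powr_three_halves_ge; simp add: power2_eq_square power3_eq_cube)+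
  then have "euler_tail (3/2) 3 * (1 + 1 * real 3 powr -(3/2)) \<le> 1"
    by (intro euler_tail_le_ratio_sum[of _ "{5,7,11,13,17}"]) auto
  then show ?thesis
    unfolding gap_start_eq by (intro inverse_le_quadratic) auto
qed

lemma zeta_2: "zeta 2 = pi\<^sup>2 / 6"
proof -
  have "zeta 2 = (\<Sum>n. 1 / (real n + 1)\<^sup>2)" by (simp add: zeta_def add.commute)
  then show ?thesis using inverse_squares_sums by (simp add: sums_iff add.commute)
qed

text \<open>At 2 both ends are explicit, by Euler's value of \<open>zeta 2\<close>. The strict
  inequality also keeps the threshold below 2.\<close>

lemma gap_start_less_euler_tail_2: "gap_start 2 < euler_tail 2 3"
proof -
  have powr: "(2::real) powr -2 = 1/4" "(3::real) powr -2 = 1/9" by (simp_all add: powr_minus_divide)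
  have "gap_start 2 = 73/81" "euler_tail 2 3 = 9 / pi\<^sup>2"
    unfolding gap_start_eq euler_tail_def partial_euler_0_3 zeta_2 powr
    by (simp_all add: power2_eq_square)
  moreover have "pi\<^sup>2 \<le> (316/100)\<^sup>2" using pi_approx by (intro power_mono) auto
  then have "pi\<^sup>2 * 73 < 9 * 81" by (simp add: power2_eq_square)
  then have "73/81 < 9 / pi\<^sup>2" by (simp add: field_simps)
  ultimately show ?thesis by simp
qed

lemma ex1_eta_A: "\<exists>!\<eta>. is_eta_A \<eta>"
proof -
  have "\<exists>r. 3/2 \<le> r \<and> r \<le> 2 \<and> euler_tail r 3 - gap_start r = 0"
  proof (rule IVT')
    show "continuous_on {3/2..2} (\<lambda>r. euler_tail r 3 - gap_start r)"
      unfolding gap_start_def by (intro continuous_intros euler_tail_3_continuous_on) auto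
  qed (use gap_start_ge_euler_tail_three_halves gap_start_less_euler_tail_2 in auto)
  then obtain r where r: "3/2 \<le> r" "r \<le> 2" "euler_tail r 3 = gap_start r" by auto
  moreover have "r \<noteq> 2" using r gap_start_less_euler_tail_2 by auto
  ultimately have "is_eta_A r" by (auto simp: is_eta_A_iff)
  moreover have "r' = r''" if "is_eta_A r'" "is_eta_A r''" for r' r''
    using that euler_tail_gt_gap_start[of r' r''] euler_tail_gt_gap_start[of r'' r']
    by (cases r' r'' rule: linorder_cases) (auto simp: is_eta_A_iff)
  ultimately show ?thesis by blast
qed

lemma euler_tail_le_gap_start_iff:
  assumes "r > 1"
  shows "euler_tail r 3 \<le> gap_start r \<longleftrightarrow> r \<le> eta_A"
proof -
  have "is_eta_A eta_A" unfolding eta_A_def using ex1_eta_A by (rule theI')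
  then have "1 < eta_A" "euler_tail eta_A 3 = gap_start eta_A" by (auto simp: is_eta_A_iff)
  moreover consider "r < eta_A" | "r = eta_A" | "r > eta_A" by linarith
  ultimately show ?thesis
    using euler_tail_gt_gap_start[of r eta_A] euler_tail_gt_gap_start[of eta_A r] assms
    by cases (use linear in fastforce)+
qed

section \<open>Density\<close>

text \<open>With \<open>x = p powr -r\<close>, the factor that \<open>p\<close> with exponent
  \<open>e\<close> contributes to \<open>s_fun (-r)\<close>.\<close>

definition alt_geom :: "real \<Rightarrow> nat \<Rightarrow> real" where
  "alt_geom x e = (\<Sum>j=0..e. (- x) ^ j)"

lemma alt_geom_Suc: "alt_geom x (Suc e) = 1 - x * alt_geom x e"
  unfolding alt_geom_def sum.atLeast0_atMost_Suc_shift by (simp add: sum_distrib_left sum_negf)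

lemma alt_geom_bounds:
  assumes "0 \<le> x" "x \<le> 1"
  shows "1 - x \<le> alt_geom x e \<and> alt_geom x e \<le> 1"
proof (induction e)
  case (Suc e)
  have "x * alt_geom x e \<le> x * 1" using Suc assms by (intro mult_left_mono) auto
  moreover have "0 \<le> x * alt_geom x e" using Suc assms by (intro mult_nonneg_nonneg) auto
  ultimately show ?case by (simp add: alt_geom_Suc)
qed (use assms in \<open>simp add: alt_geom_def\<close>)

text \<open>By the recursion, a value with positive exponent is 1 minus \<open>x\<close> times a
  value that is at least \<open>1 - x\<close>.\<close>

lemma alt_geom_pos_le:
  assumes "0 \<le> x" "x \<le> 1" "e > 0"
  shows "alt_geom x e \<le> 1 - x + x\<^sup>2"
proof (cases e)
  case (Suc d)
  have "x * (1 - x) \<le> x * alt_geom x d"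
    using assms alt_geom_bounds[of x d] by (intro mult_left_mono) auto
  then show ?thesis using Suc by (simp add: alt_geom_Suc algebra_simps power2_eq_square)
qed (use assms in simp)

lemma alt_geom_simps:
  "alt_geom x 0 = 1" "alt_geom x 1 = 1 - x" "alt_geom x 2 = 1 - x + x\<^sup>2"
  "alt_geom x 3 = (1 - x) * (1 + x\<^sup>2)"
  by (simp_all add: alt_geom_def numeral_2_eq_2 numeral_3_eq_3 algebra_simps)

text \<open>The exponents \<open>0\<close>, \<open>2\<close>, \<open>3\<close>, \<open>1\<close>, in decreasing order of the values, already suffice.\<close>

lemma alt_geom_cover:
  fixes x R v :: real
  assumes x: "0 < x" "x \<le> 1/2" and R: "0 < R" "R \<le> 1 - x + x\<^sup>2"
    and v: "(1 - x) * R \<le> v" "v \<le> 1"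
  shows "\<exists>e. alt_geom x e * R \<le> v \<and> v \<le> alt_geom x e"
proof -
  \<comment> \<open>This polynomial is the slack in both overlaps below.\<close>
  have cubic: "0 \<le> 1 - 2 * x + x\<^sup>2 - x ^ 3"
  proof -
    have "1 - 2 * x + x\<^sup>2 - x ^ 3 = (1 - 2 * x) + x\<^sup>2 * (1 - x)"
      by (simp add: power2_eq_square power3_eq_cube right_diff_distrib)
    moreover have "0 \<le> x\<^sup>2 * (1 - x)" using x by simp
    ultimately show ?thesis using x by linarith
  qed
  \<comment> \<open>The intervals from \<open>alt_geom x e * R\<close> to
    \<open>alt_geom x e\<close> overlap for \<open>e = 2\<close> and \<open>e = 3\<close>;
    \<open>step3\<close> treats 3 and 1. For 0 and 2 the overlap is the hypothesis on
    \<open>R\<close>.\<close>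
  have step2: "alt_geom x 2 * R \<le> alt_geom x 3"
  proof -
    have "(1 - x + x\<^sup>2) * R \<le> (1 - x + x\<^sup>2) * (1 - x + x\<^sup>2)"
      using R x by (intro mult_left_mono add_nonneg_nonneg) auto
    also have "\<dots> = (1 - x) * (1 + x\<^sup>2) - x * (1 - 2 * x + x\<^sup>2 - x ^ 3)"
      by (simp add: power2_eq_square power3_eq_cube ring_distribs)
    also have "\<dots> \<le> (1 - x) * (1 + x\<^sup>2)"
      using mult_nonneg_nonneg[OF less_imp_le[OF x(1)] cubic] by linarith
    finally show ?thesis by (simp only: alt_geom_simps)
  qed
  have step3: "alt_geom x 3 * R \<le> alt_geom x 1"
  proof -
    have "(1 + x\<^sup>2) * R \<le> (1 + x\<^sup>2) * (1 - x + x\<^sup>2)"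
      using R by (intro mult_left_mono) auto
    also have "\<dots> = 1 - x * (1 - 2 * x + x\<^sup>2 - x ^ 3)"
      by (simp add: power2_eq_square power3_eq_cube ring_distribs)
    also have "\<dots> \<le> 1"
      using mult_nonneg_nonneg[OF less_imp_le[OF x(1)] cubic] by linarith
    finally have "(1 - x) * ((1 + x\<^sup>2) * R) \<le> (1 - x) * 1"
      using x by (intro mult_left_mono) auto
    then show ?thesis by (simp only: alt_geom_simps mult.assoc mult_1_right)
  qed
  show ?thesis
  proof (cases "R \<le> v")
    case True
    then show ?thesis using v by (intro exI[of _ 0]) (simp add: alt_geom_simps(1))
  next
    case False
    then have 2: "v \<le> alt_geom x 2" unfolding alt_geom_simps using R by linarith
    show ?thesis
    proof (cases "alt_geom x 2 * R \<le> v")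
      case False
      then have 3: "v \<le> alt_geom x 3" using step2 by linarith
      show ?thesis
      proof (cases "alt_geom x 3 * R \<le> v")
        case False
        then have "v \<le> alt_geom x 1" using step3 by linarith
        then show ?thesis using v alt_geom_simps(2) by metis
      qed (use 3 in blast)
    qed (use 2 in blast)
  qed
qed

section \<open>Greedy construction and density\<close>

lemma s_fun_neg_eq:
  "s_fun (-r) n = (\<Prod>p\<in>prime_factors n. alt_geom (real p powr -r) (multiplicity p n))"
  by (simp add: s_fun_def alt_geom_def)

lemma alt_geom_prime_bounds:
  fixes p :: nat
  assumes "r > 1" "prime p"
  shows "1 - real p powr -r \<le> alt_geom (real p powr -r) e" "alt_geom (real p powr -r) e \<le> 1"
    "alt_geom (real p powr -r) e > 0"
  using alt_geom_bounds[of "real p powr -r" e] prime_powr_neg_bounds[OF assms] by auto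

lemma s_fun_mult_prime_power:
  fixes p :: nat
  assumes "prime p" "n > 0" "\<not> p dvd n"
  shows "s_fun (-r) (n * p ^ e) = s_fun (-r) n * alt_geom (real p powr -r) e"
proof (cases "e = 0")
  case False
  then have "s_fun (-r) (n * p ^ e) = s_fun (-r) n * s_fun (-r) (p ^ e)"
    using assms prime_imp_coprime[of p n]
    by (intro s_fun_mult_coprime) (auto simp: prime_gt_0_nat coprime_commute)
  then show ?thesis using False assms by (simp add: s_fun_prime_power alt_geom_def)
qed (simp add: alt_geom_def)

text \<open>The invariant says that \<open>v\<close> can still be reached with primes beyond
  \<open>k\<close>. At a prime \<open>q = Suc k\<close>, \<open>alt_geom_cover\<close> applied to
  \<open>v\<close> divided by the current value supplies an exponent that preserves it.\<close>

lemma greedy_approximation: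
  assumes "r > 1"
    and gap: "\<And>q. prime q \<Longrightarrow> euler_tail r q \<le> 1 - real q powr -r + (real q powr -r)\<^sup>2"
    and v: "1 / zeta r \<le> v" "v \<le> 1"
  shows "\<exists>n>0. (\<forall>p. prime p \<longrightarrow> p dvd n \<longrightarrow> p \<le> k) \<and> s_fun (-r) n \<le> 1 \<and>
    s_fun (-r) n * euler_tail r k \<le> v \<and> v \<le> s_fun (-r) n"
proof (induction k)
  case 0
  have "s_fun (-r) 1 = 1" by (rule s_fun_1)
  then show ?case using v by (intro exI[of _ 1]) (auto simp: euler_tail_0)
next
  case (Suc k)
  then obtain n where n: "n > 0" "\<And>p. prime p \<Longrightarrow> p dvd n \<Longrightarrow> p \<le> k" "s_fun (-r) n \<le> 1"
    "s_fun (-r) n * euler_tail r k \<le> v" "v \<le> s_fun (-r) n" by blast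
  have tail: "euler_tail r k = partial_euler r k (Suc k) * euler_tail r (Suc k)"
    using assms by (intro euler_tail_split) auto
  show ?case
  proof (cases "prime (Suc k)")
    case False
    then have "euler_tail r (Suc k) = euler_tail r k" using tail by (simp add: partial_euler_Suc)
    then show ?thesis using n by (intro exI[of _ n]) (auto intro: le_SucI)
  next
    case True
    define q where "q = Suc k"
    define x where "x = real q powr -r"
    define s where "s = s_fun (-r) n"
    have q: "prime q" using True by (simp add: q_def)
    have "0 < v" using v(1) zeta_pos[OF assms(1)] by (meson less_le_trans zero_less_divide_1_iff)
    then have s: "s > 0" using n by (simp add: s_def)
    have "\<exists>e. alt_geom x e * euler_tail r q \<le> v / s \<and> v / s \<le> alt_geom x e"
    proof (rule alt_geom_cover)
      show "0 < x" "x \<le> 1/2" using prime_powr_neg_bounds[OF assms(1) q] by (auto simp: x_def)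
      show "0 < euler_tail r q" by (rule euler_tail_pos[OF assms(1)])
      show "euler_tail r q \<le> 1 - x + x\<^sup>2" using gap[OF q] by (simp add: x_def)
      have "euler_tail r k = (1 - x) * euler_tail r q"
        using tail True by (simp only: partial_euler_Suc if_True x_def q_def)
      then have "(1 - x) * euler_tail r q * s \<le> v"
        using n(4) by (simp add: s_def mult.commute)
      then show "(1 - x) * euler_tail r q \<le> v / s" using s by (simp only: pos_le_divide_eq)
      show "v / s \<le> 1" using n s by (simp add: s_def)
    qed
    then obtain e where e: "alt_geom x e * euler_tail r q \<le> v / s" "v / s \<le> alt_geom x e" by blast
    have "\<not> q dvd n" using n(2)[of q] q by (auto simp: q_def)
    then have eq: "s_fun (-r) (n * q ^ e) = s * alt_geom x e"
      using s_fun_mult_prime_power[OF q n(1)] by (simp add: s_def x_def)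
    have "s * alt_geom x e \<le> 1 * 1"
      using n s alt_geom_prime_bounds[OF assms(1) q, of e] by (intro mult_mono) (auto simp: s_def x_def)
    moreover have "s * alt_geom x e * euler_tail r q \<le> v" "v \<le> s * alt_geom x e"
      using e s by (simp_all add: field_simps)
    moreover have "p \<le> Suc k" if "prime p" "p dvd n * q ^ e" for p
    proof -
      have "p dvd n \<or> p dvd q" using that by (meson prime_dvd_mult_iff prime_dvd_power)
      then show ?thesis using n(2)[of p] that(1) q primes_dvd_imp_eq[of p q] by (auto simp: q_def)
    qed
    moreover have "n * q ^ e > 0" using n(1) q prime_gt_0_nat by simp
    ultimately show ?thesis unfolding eq[symmetric] q_def[symmetric] by (metis mult_1)
  qed
qed

lemma dense_if_gap_condition:
  assumes "r > 1"
    and gap: "\<And>q. prime q \<Longrightarrow> euler_tail r q \<le> 1 - real q powr -r + (real q powr -r)\<^sup>2"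
  shows "dense_in {s_fun (-r) n | n. n > 0} {1 / zeta r<..1}"
  unfolding dense_in_def
proof
  fix v assume v: "v \<in> {1 / zeta r<..1}"
  show "v \<in> closure ({s_fun (-r) n | n. n > 0} \<inter> {1 / zeta r<..1})"
    unfolding closure_approachable
  proof (intro allI impI)
    fix \<epsilon> :: real assume "\<epsilon> > 0"
    then have "\<forall>\<^sub>F k in sequentially. dist (euler_tail r k) 1 < \<epsilon>"
      using euler_tail_tendsto[OF assms(1)] by (rule tendstoD[rotated])
    then obtain k where k: "dist (euler_tail r k) 1 < \<epsilon>"
      by (meson eventually_sequentially order_refl)
    obtain n where n: "n > 0" "s_fun (-r) n \<le> 1"
      "s_fun (-r) n * euler_tail r k \<le> v" "v \<le> s_fun (-r) n"
      using greedy_approximation[OF assms(1) gap, of v k] v by auto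
    \<comment> \<open>The left side is the length of the interval that traps \<open>v\<close>; it
      tends to 0 with growing \<open>k\<close>.\<close>
    have "s_fun (-r) n * (1 - euler_tail r k) \<le> 1 * (1 - euler_tail r k)"
      using n euler_tail_le_1[OF assms(1)] by (intro mult_right_mono) auto
    then have "dist (s_fun (-r) n) v < \<epsilon>"
      using n k euler_tail_le_1[OF assms(1), of k] by (simp add: dist_real_def algebra_simps)
    \<comment> \<open>The approximants lie between \<open>v\<close> and 1, so they stay inside the
      half-open interval.\<close>
    then show "\<exists>y\<in>{s_fun (-r) n | n. n > 0} \<inter> {1 / zeta r<..1}. dist y v < \<epsilon>"
      using n v by (intro bexI[of _ "s_fun (-r) n"]) auto
  qed
qed

section \<open>The gap beyond the threshold\<close>

lemma s_fun_le_of_prime_dvd: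
  fixes q :: nat
  assumes "r > 1" "n > 0" "prime q" "q dvd n"
  shows "s_fun (-r) n \<le> 1 - real q powr -r + (real q powr -r)\<^sup>2"
proof -
  let ?d = "\<lambda>p. alt_geom (real p powr -r) (multiplicity p n)"
  have q: "q \<in> prime_factors n" using assms by (simp add: prime_factors_dvd)
  have b: "0 < ?d p \<and> ?d p \<le> 1" if "p \<in> prime_factors n" for p
    using alt_geom_prime_bounds[OF assms(1), of p] that by auto
  have "s_fun (-r) n = ?d q * (\<Prod>p\<in>prime_factors n - {q}. ?d p)"
    unfolding s_fun_neg_eq using q by (subst prod.remove) auto
  also have "\<dots> \<le> ?d q * 1"
    using b q by (intro mult_left_mono prod_le_1) (auto intro: less_imp_le)
  also have "?d q \<le> 1 - real q powr -r + (real q powr -r)\<^sup>2"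
    using prime_powr_neg_bounds[OF assms(1,3)] assms
    by (intro alt_geom_pos_le) (auto simp: prime_multiplicity_gt_zero_iff)
  finally show ?thesis by simp
qed

lemma s_fun_ge_euler_tail:
  assumes "r > 1" "n > 0" "\<And>p. prime p \<Longrightarrow> p dvd n \<Longrightarrow> k < p" "k \<le> n"
  shows "euler_tail r k \<le> s_fun (-r) n"
proof -
  have "euler_tail r k \<le> partial_euler r k n"
    using assms by (intro euler_tail_le_partial_euler)
  also have "\<dots> \<le> (\<Prod>p\<in>prime_factors n. 1 - real p powr -r)"
    using assms by (intro partial_euler_le_prod_subset) (auto intro: dvd_imp_le)
  also have "\<dots> \<le> s_fun (-r) n"
    unfolding s_fun_neg_eq
  proof (intro prod_mono conjI)
    fix p assume "p \<in> prime_factors n"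
    then have "prime p" by auto
    then show "0 \<le> 1 - real p powr -r"
      "1 - real p powr -r \<le> alt_geom (real p powr -r) (multiplicity p n)"
      using partial_euler_factor_bounds(1)[OF assms(1)] alt_geom_prime_bounds(1)[OF assms(1)]
      by (blast intro: less_imp_le)+
  qed
  finally show ?thesis .
qed

text \<open>A factor 2 or 3 in \<open>n\<close> forces the value down to \<open>gap_start r\<close>
  or below; for \<open>n\<close> coprime to 6 only primes beyond 3 occur, and their factors multiply
  to at least the tail.\<close>

lemma s_fun_gap:
  assumes "r > 1" "n > 0"
  shows "s_fun (-r) n \<le> gap_start r \<or> euler_tail r 3 \<le> s_fun (-r) n"
proof -
  define x y where "x = (2::real) powr -r" and "y = (3::real) powr -r"
  consider "2 dvd n" | "3 dvd n" | "\<not> 2 dvd n" "\<not> 3 dvd n" by blast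
  then show ?thesis
  proof cases
    case 1
    \<comment> \<open>Since \<open>1 - t + t\<^sup>2\<close> decreases up to 1/2, the bound for the
      prime 2 lies below the one for 3.\<close>
    have "y \<le> x" unfolding x_def y_def using assms by (intro powr_mono2') auto
    moreover have "x < 1/2" "y < 1/3"
      using two_powr_bounds[OF assms(1)] three_powr_bounds[OF assms(1)] by (auto simp: x_def y_def)
    ultimately have "0 \<le> (x - y) * (1 - x - y)" by (intro mult_nonneg_nonneg) auto
    then have "1 - x + x\<^sup>2 \<le> gap_start r"
      unfolding gap_start_eq y_def[symmetric] by (simp add: algebra_simps power2_eq_square)
    then show ?thesis
      using s_fun_le_of_prime_dvd[OF assms two_is_prime_nat 1] by (simp add: x_def)
  next
    case 2
    then show ?thesis
      using s_fun_le_of_prime_dvd[OF assms _ 2] by (simp add: gap_start_eq)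
  next
    case 3
    show ?thesis
    \<comment> \<open>The value 1 is treated apart because \<open>s_fun_ge_euler_tail\<close> asks
      for \<open>3 \<le> n\<close>.\<close>
    proof (cases "n = 1")
      case True
      then show ?thesis using euler_tail_le_1[OF assms(1)] s_fun_1 by simp
    next
      case False
      have "n \<noteq> 2" "n \<noteq> 3" using 3 by auto
      then have "3 \<le> n" using False assms(2) by linarith
      moreover have "3 < p" if "prime p" "p dvd n" for p
      proof -
        have "p \<noteq> 2" "p \<noteq> 3" using that 3 by auto
        then show ?thesis using prime_ge_2_nat[OF that(1)] by linarith
      qed
      ultimately show ?thesis using s_fun_ge_euler_tail[OF assms, of 3] by blast
    qed
  qed
qed

lemma not_dense_if_gap:
  assumes "r > 1" "gap_start r < euler_tail r 3"
  shows "\<not> dense_in {s_fun (-r) n | n. n > 0} {1 / zeta r<..1}"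
proof
  assume dense: "dense_in {s_fun (-r) n | n. n > 0} {1 / zeta r<..1}"
  define U where "U = {gap_start r<..<euler_tail r 3}"
  define v where "v = (gap_start r + euler_tail r 3) / 2"
  have v: "v \<in> U" using assms by (simp add: U_def v_def)
  \<comment> \<open>Shows that the gap lies above the left end of the interval, so its midpoint
    \<open>v\<close> belongs to the interval.\<close>
  have "1 / zeta r = (1 - 2 powr -r) * (1 - 3 powr -r) * euler_tail r 3"
    using euler_tail_split[of r 0 3] assms by (simp add: euler_tail_0 partial_euler_0_3)
  also have "\<dots> \<le> 1 * (1 - 3 powr -r) * 1"
    using two_powr_bounds[OF assms(1)] three_powr_bounds[OF assms(1)]
      euler_tail_le_1[OF assms(1), of 3] euler_tail_pos[OF assms(1), of 3]
    by (intro mult_mono) auto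
  also have "\<dots> \<le> gap_start r" by (simp add: gap_start_eq)
  finally have "v \<in> {1 / zeta r<..1}"
    using v euler_tail_le_1[OF assms(1), of 3] by (simp add: U_def)
  then have "v \<in> closure ({s_fun (-r) n | n. n > 0} \<inter> {1 / zeta r<..1})"
    using dense by (auto simp: dense_in_def)
  moreover have "open U" by (simp add: U_def)
  ultimately have "U \<inter> ({s_fun (-r) n | n. n > 0} \<inter> {1 / zeta r<..1}) \<noteq> {}"
    using v open_Int_closure_eq_empty by blast
  then obtain n where "n > 0" "s_fun (-r) n \<in> U" by blast
  then show False using s_fun_gap[OF assms(1), of n] by (auto simp: U_def)
qed

lemma eta_A_less_2: "eta_A < 2"
proof -
  have "is_eta_A eta_A" unfolding eta_A_def using ex1_eta_A by (rule theI')
  then show ?thesis by (simp add: is_eta_A_def)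
qed

theorem theorem2p4:
  shows "(\<exists>!\<eta>. is_eta_A \<eta>) \<and>
    (\<forall>r::real. r > 1 \<longrightarrow>
      (dense_in {s_fun (-r) n | n. n > 0} {1 / zeta r<..1} \<longleftrightarrow> r \<le> eta_A))"
proof (intro conjI allI impI)
  show "\<exists>!\<eta>. is_eta_A \<eta>" by (rule ex1_eta_A)
  fix r :: real assume r: "r > 1"
  show "dense_in {s_fun (-r) n | n. n > 0} {1 / zeta r<..1} \<longleftrightarrow> r \<le> eta_A"
  proof
    assume "r \<le> eta_A"
    then have "r \<le> 2" "euler_tail r 3 \<le> gap_start r"
      using eta_A_less_2 euler_tail_le_gap_start_iff[OF r] by auto
    then show "dense_in {s_fun (-r) n | n. n > 0} {1 / zeta r<..1}"
      using r gap_condition by (intro dense_if_gap_condition) auto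
  next
    assume "dense_in {s_fun (-r) n | n. n > 0} {1 / zeta r<..1}"
    then show "r \<le> eta_A"
      using not_dense_if_gap[OF r] euler_tail_le_gap_start_iff[OF r] by linarith
  qed
qed

end
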